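(* Let $\Gamma$ be a simply-laced Dynkin diagram of type $A,D,E$ with Coxeter number $h$. For all vertices $i,j$ of $\Gamma$ and all $l\ge0$ there is a quasi-isomorphism of complexes $A_{i,j;l}[2]\simeq A_{i,j;l+2h}$ (where $(C[2])^k=C^{k+2}$). In particular $H^{k+2}(A_{i,j;l})\cong H^k(A_{i,j;l+2h})$ for all $k$.
   Context: Fix a field $\mathbb K$. Let $\overline\Gamma$ be the double quiver of $\Gamma$ with arrows $e^{ij}\colon i\to j$ and $e^{ji}\colon j\to i$ for each edge $i - j$; fix $\epsilon(e^{ij})=-\epsilon(e^{ji})\in\{\pm1\}$; paths are composed right to left; $\theta_i=\sum_j\epsilon(e^{ij})e^{ji}e^{ij}$ (sum over neighbours $j$ of $i$). $A$ is the path algebra of $\overline\Gamma$ with adjoined generators $l_i$ ($i$ a vertex), $l_ie_j=e_jl_i=\delta_{ij}l_i$; it is spanned by words $p_1l_{i_1}p_2\cdots p_kl_{i_k}p_{k+1}$ with $p_a$ a path from $i_a$ to $i_{a-1}$. Arrows have length 1, each $l_i$ length 2, idempotents length 0. $A^{-k}_{i,j;l}$ is the span of such words going from $i$ to $j$ of total length $l$ with exactly $k$ letters $l$; $A_{i,j;l}$ is the complex with degree $-k$ term $A^{-k}_{i,j;l}$ and differential $d(p_1l_{i_1}\cdots p_kl_{i_k}p_{k+1})=\sum_{a=1}^k(-1)^{a+1}p_1l_{i_1}\cdots p_a\theta_{i_a}p_{a+1}\cdots l_{i_k}p_{k+1}$. (This is the Koszul complex of the preprojective algebra, graded by endpoints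 and length.) *)

theory Defs
  imports Main
begin

datatype dynkin = TypeA nat | TypeD nat | TypeE nat

fun dynkin_valid :: "dynkin \<Rightarrow> bool" where
  "dynkin_valid (TypeA n) = (n \<ge> 1)"
| "dynkin_valid (TypeD n) = (n \<ge> 4)"
| "dynkin_valid (TypeE n) = (n \<in> {6,7,8})"

fun rank :: "dynkin \<Rightarrow> nat" where
  "rank (TypeA n) = n"
| "rank (TypeD n) = n"
| "rank (TypeE n) = n"

fun dyn_edge :: "dynkin \<Rightarrow> nat \<Rightarrow> nat \<Rightarrow> bool" where
  "dyn_edge (TypeA n) u v = (v = Suc u \<and> v < n)"
| "dyn_edge (TypeD n) u v = ((v = Suc u \<and> v < n - 1) \<or> (u = n - 3 \<and> v = n - 1))"
| "dyn_edge (TypeE n) u v = ((v = Suc u \<and> v < n - 1) \<or> (u = 2 \<and> v = n - 1))"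

definition adj :: "dynkin \<Rightarrow> nat \<Rightarrow> nat \<Rightarrow> bool" where
  "adj t u v \<longleftrightarrow> dyn_edge t u v \<or> dyn_edge t v u"

fun coxeter_number :: "dynkin \<Rightarrow> nat" where
  "coxeter_number (TypeA n) = n + 1"
| "coxeter_number (TypeD n) = 2 * n - 2"
| "coxeter_number (TypeE n) = (if n = 6 then 12 else if n = 7 then 18 else 30)"

section \<open>Words in the algebra A (path algebra of the double quiver with loops l_i)\<close>

text \<open>A letter is an arrow e^{uv} : u \<rightarrow> v (written Arr u v) or a generator l_u (written Lp u).
  A word is the list of its letters in written order (composition right to left), so
  the last letter is traversed first.\<close>
datatype letter = Arr nat nat | Lp nat

fun lsrc :: "letter \<Rightarrow> nat" where
  "lsrc (Arr u v) = u" | "lsrc (Lp u) = u"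
fun ltgt :: "letter \<Rightarrow> nat" where
  "ltgt (Arr u v) = v" | "ltgt (Lp u) = u"

fun letter_ok :: "dynkin \<Rightarrow> letter \<Rightarrow> bool" where
  "letter_ok t (Arr u v) = adj t u v"
| "letter_ok t (Lp u) = (u < rank t)"

fun letter_len :: "letter \<Rightarrow> nat" where
  "letter_len (Arr u v) = 1" | "letter_len (Lp u) = 2"

fun is_L :: "letter \<Rightarrow> bool" where
  "is_L (Arr u v) = False" | "is_L (Lp u) = True"

definition wlen :: "letter list \<Rightarrow> nat" where
  "wlen w = sum_list (map letter_len w)"

definition nL :: "letter list \<Rightarrow> nat" where
  "nL w = length (filter is_L w)"

definition word_from :: "dynkin \<Rightarrow> nat \<Rightarrow> nat \<Rightarrow> letter list \<Rightarrow> bool" where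
  "word_from t i j w \<longleftrightarrow> i < rank t \<and> j < rank t \<and> (\<forall>x\<in>set w. letter_ok t x) \<and>
     (if w = [] then i = j
      else ltgt (hd w) = j \<and> lsrc (last w) = i \<and>
           (\<forall>p. Suc p < length w \<longrightarrow> lsrc (w ! p) = ltgt (w ! Suc p)))"

definition basis :: "dynkin \<Rightarrow> nat \<Rightarrow> nat \<Rightarrow> nat \<Rightarrow> int \<Rightarrow> letter list set" where
  "basis t i j l m = {w. word_from t i j w \<and> wlen w = l \<and> int (nL w) = - m}"

text \<open>Degree-m term of A_{i,j;l}: K-linear combinations of basis words (as coefficient functions).\<close>
definition cochains :: "dynkin \<Rightarrow> nat \<Rightarrow> nat \<Rightarrow> nat \<Rightarrow> int \<Rightarrow> (letter list \<Rightarrow> 'k::field) set" where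
  "cochains t i j l m = {f. \<forall>w. w \<notin> basis t i j l m \<longrightarrow> f w = 0}"

text \<open>Differential on a basis word: sum over a of (-1)^(a+1) times the word with its a-th
  letter l_{i_a} (counted left to right) replaced by
  theta_{i_a} = sum_v eps(e^{i_a v}) e^{v i_a} e^{i_a v}.\<close>
definition dbasis :: "dynkin \<Rightarrow> (nat \<Rightarrow> nat \<Rightarrow> int) \<Rightarrow> letter list \<Rightarrow> letter list \<Rightarrow> 'k::field" where
  "dbasis t eps w w' =
     (\<Sum>p<length w. case w ! p of
        Arr _ _ \<Rightarrow> 0
      | Lp u \<Rightarrow> (-1) ^ nL (take p w) *
          (\<Sum>v\<in>{v. v < rank t \<and> adj t u v}. of_int (eps u v) *
              (if w' = take p w @ [Arr v u, Arr u v] @ drop (Suc p) w then 1 else 0)))"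

definition diff :: "dynkin \<Rightarrow> (nat \<Rightarrow> nat \<Rightarrow> int) \<Rightarrow> nat \<Rightarrow> nat \<Rightarrow> nat \<Rightarrow> int
    \<Rightarrow> (letter list \<Rightarrow> 'k::field) \<Rightarrow> (letter list \<Rightarrow> 'k)" where
  "diff t eps i j l m f = (\<lambda>w'. \<Sum>w\<in>basis t i j l m. f w * dbasis t eps w w')"

definition lin_on :: "('a \<Rightarrow> 'k::field) set \<Rightarrow> (('a \<Rightarrow> 'k) \<Rightarrow> ('b \<Rightarrow> 'k)) \<Rightarrow> bool" where
  "lin_on S g \<longleftrightarrow> (\<forall>x\<in>S. \<forall>y\<in>S. g (\<lambda>w. x w + y w) = (\<lambda>w. g x w + g y w)) \<and>
                  (\<forall>c. \<forall>x\<in>S. g (\<lambda>w. c * x w) = (\<lambda>w. c * g x w))"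

definition quasi_iso ::
  "(int \<Rightarrow> ('a \<Rightarrow> 'k::field) set) \<Rightarrow> (int \<Rightarrow> ('a \<Rightarrow> 'k) \<Rightarrow> ('a \<Rightarrow> 'k)) \<Rightarrow>
   (int \<Rightarrow> ('b \<Rightarrow> 'k) set) \<Rightarrow> (int \<Rightarrow> ('b \<Rightarrow> 'k) \<Rightarrow> ('b \<Rightarrow> 'k)) \<Rightarrow>
   (int \<Rightarrow> ('a \<Rightarrow> 'k) \<Rightarrow> ('b \<Rightarrow> 'k)) \<Rightarrow> bool" where
  "quasi_iso C dC D dD phi \<longleftrightarrow>
     (\<forall>n. lin_on (C n) (phi n) \<and> phi n ` C n \<subseteq> D n) \<and>
     (\<forall>n. \<forall>x\<in>C n. phi (n + 1) (dC n x) = dD n (phi n x)) \<and>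
     (\<forall>n. \<forall>z\<in>D n. dD n z = (\<lambda>_. 0) \<longrightarrow>
        (\<exists>x\<in>C n. dC n x = (\<lambda>_. 0) \<and>
           (\<exists>y\<in>D (n - 1). (\<lambda>w. phi n x w - z w) = dD (n - 1) y))) \<and>
     (\<forall>n. \<forall>x\<in>C n. dC n x = (\<lambda>_. 0) \<longrightarrow> (\<exists>y\<in>D (n - 1). phi n x = dD (n - 1) y) \<longrightarrow>
        (\<exists>x'\<in>C (n - 1). x = dC (n - 1) x'))"

end

(* Splitting off the last traversed letter exhibits A_{i,j;l} as the cone of left multiplication by
   theta_j from A_{i,j;l-2} to the sum of the A_{i,v;l-1} over the neighbours v of j. Let Pi_l(v) be
   the degree 0 cohomology of A_{i,v;l}. The arrows make Pi_l and Pi_{l+1} a representation of the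
   bipartite double cover of the diagram, and passing from l to l+1 is a reflection functor. Such a
   functor preserves the property that all endomorphisms are scalars, unless it kills a simple
   summand, and then the representation is that simple. Hence the cohomology is concentrated in
   degree 0 until, for some l, Pi_l is one-dimensional and supported at one vertex i* while A_{i,v;l+1}
   is acyclic for all v. Euler characteristics, computed from one end vertex only, show that l = h - 2
   for all i. There is then a cocycle z_i of length h and degree -1 from i to i*, and the five lemma
   for the cones shows that right multiplication by z_i is a quasi-isomorphism from A_{i*,j;l}[1] to
   A_{i,j;l+h}. As i** = i, right multiplication by z_{i*} z_i is the required map. *)

theory Submission
  imports Defs HOL.Vector_Spaces "HOL-Library.Function_Algebras"
begin

text \<open>The pointwise rules would fire inside the eta-long function terms left behind by the induction method.\<close>
declare plus_fun_apply [simp del] zero_fun_apply [simp del] minus_apply [simp del] uminus_apply [simp del]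

text \<open>Neither the structure of the preprojective algebra nor a classification of
  representations is needed. If theta is injective on Pi_l, then Pi_l(v) is the kernel of the
  surjection from the sum of the Pi_{l+1}(u) to Pi_{l+2}(v). Endomorphisms therefore pass down to
  kernels, and scalars come back up because arrows generate Pi_{l+2}. If theta kills a vector x0
  outside the boundaries, a functional g with g(x0) = 1 gives the rank one endomorphism x -> g(x)
  x0; that it is a scalar forces a one-dimensional representation. The obstacle is that this might
  happen at different l for different i. With N the adjacency matrix, the matrices M_l of Euler
  characteristics satisfy the Chebyshev recursion M_l = N M_{l-1} - M_{l-2}, so they commute with N,
  and as long as their entries are nonnegative a zero row spreads over the connected diagram. Hence
  one row decides for all. The M_l are also symmetric, which makes i -> i* an involution; it is the
  Nakayama permutation. Since z_i ends at i* and not at i, only a product of two such cocycles gives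
  a map between complexes with the same end points, whence [2] and 2h.\<close>

definition smul :: "'k::field \<Rightarrow> ('a \<Rightarrow> 'k) \<Rightarrow> 'a \<Rightarrow> 'k" where
  "smul c f = (\<lambda>w. c * f w)"

interpretation fvs: vector_space "smul :: 'k::field \<Rightarrow> ('a \<Rightarrow> 'k) \<Rightarrow> 'a \<Rightarrow> 'k"
  by unfold_locales (auto simp: smul_def fun_eq_iff plus_fun_apply algebra_simps)

lemma smul_simps: "smul c f w = c * f w"
  by (simp add: smul_def)

lemmas fun_apply = plus_fun_apply zero_fun_apply minus_apply uminus_apply smul_simps

section \<open>Functions on words and the differential\<close>

definition lmul :: "letter \<Rightarrow> (letter list \<Rightarrow> 'k::field) \<Rightarrow> letter list \<Rightarrow> 'k" where
  "lmul a f w = (case w of [] \<Rightarrow> 0 | b # w' \<Rightarrow> if b = a then f w' else 0)"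

definition coef :: "letter \<Rightarrow> (letter list \<Rightarrow> 'k::field) \<Rightarrow> letter list \<Rightarrow> 'k" where
  "coef a f = (\<lambda>w. f (a # w))"

lemma lmul_simps [simp]: "lmul a f [] = 0" "lmul a f (b # w) = (if b = a then f w else 0)"
  by (auto simp: lmul_def)

lemma coef_simps [simp]:
  "coef a 0 = 0" "coef a (f + g) = coef a f + coef a g" "coef a (f - g) = coef a f - coef a g"
  "coef a (- f) = - coef a f" "coef a (smul c f) = smul c (coef a f)"
  "coef a (lmul b f) = (if a = b then f else 0)"
  by (auto simp: coef_def smul_def fun_eq_iff fun_apply)

lemma lmul_linear [simp]:
  "lmul a 0 = 0" "lmul a (f + g) = lmul a f + lmul a g" "lmul a (f - g) = lmul a f - lmul a g"
  "lmul a (- f) = - lmul a f" "lmul a (smul c f) = smul c (lmul a f)"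
  by (auto simp: lmul_def smul_def fun_eq_iff fun_apply split: list.splits)

lemma fun_sum_apply: "(sum f S) w = (\<Sum>x\<in>S. f x w)"
  by (induction S rule: infinite_finite_induct) (auto simp: fun_apply)

lemma coef_sum: "coef a (sum f S) = (\<Sum>x\<in>S. coef a (f x))"
  by (auto simp: coef_def fun_eq_iff fun_sum_apply)

lemma lmul_sum: "lmul a (sum f S) = (\<Sum>x\<in>S. lmul a (f x))"
  by (induction S rule: infinite_finite_induct) auto

lemma word_fun_eqI:
  assumes "f [] = g []" and "\<And>a. coef a f = coef a g"
  shows "f = g"
proof
  fix w show "f w = g w"
    using assms(1) assms(2)[of "hd w"] by (cases w) (auto simp: coef_def fun_eq_iff)
qed

text \<open>Read off from d(l_u g) = theta_u g - l_u (d g) and from the fact that arrows pass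
  through d without a sign. The recursion runs over the word at which the result is evaluated, so no
  finiteness of supports is needed and identities become inductions on words. Agreement with
  \<open>diff\<close> is \<open>diff_eq_d\<close>.\<close>

fun koszul_d :: "dynkin \<Rightarrow> (nat \<Rightarrow> nat \<Rightarrow> int) \<Rightarrow> (letter list \<Rightarrow> 'k::field) \<Rightarrow> letter list \<Rightarrow> 'k" where
  "koszul_d t eps f [] = 0"
| "koszul_d t eps f (Lp u # w) = - koszul_d t eps (coef (Lp u) f) w"
| "koszul_d t eps f (Arr v u # w) = koszul_d t eps (coef (Arr v u) f) w +
     (if adj t u v then of_int (eps u v) * lmul (Arr u v) (coef (Lp u) f) w else 0)"

section \<open>Linear algebra in function spaces\<close>

lemma separating_functional:
  fixes x :: "'a \<Rightarrow> 'k::field"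
  assumes "fvs.subspace V" and "x \<notin> V"
  shows "\<exists>g. (\<forall>y z. g (y + z) = g y + g z) \<and> (\<forall>c y. g (smul c y) = c * g y) \<and> g x = 1 \<and> (\<forall>y\<in>V. g y = 0)"
proof -
  interpret P: vector_space_pair "smul :: 'k \<Rightarrow> ('a \<Rightarrow> 'k) \<Rightarrow> 'a \<Rightarrow> 'k" "(*) :: 'k \<Rightarrow> 'k \<Rightarrow> 'k"
    by unfold_locales (auto simp: algebra_simps)
  obtain S where S: "S \<subseteq> V" "fvs.independent S" "V \<subseteq> fvs.span S"
    using fvs.maximal_independent_subset by blast
  have sp: "fvs.span S = V" using S assms(1) fvs.span_minimal by blast
  then have "fvs.independent (insert x S)"
    using assms(2) S(2) fvs.independent_insertI by metis
  then obtain g where g: "Vector_Spaces.linear smul (*) g" "\<forall>y\<in>insert x S. g y = (if y = x then 1 else 0)"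
    using P.linear_independent_extend[of "insert x S" "\<lambda>y. if y = x then 1 else 0"] by blast
  have "g y = 0" if "y \<in> S" for y using g(2) that S(1) assms(2) by auto
  then have "g y = 0" if "y \<in> V" for y 
    using P.linear_eq_0_on_span[OF g(1)] sp that by blast
  then show ?thesis using g(2)
    by (intro exI[of _ g]) (auto simp: P.linear_add[OF g(1)] P.linear_scale[OF g(1)])
qed

lemma finite_basis_extension:
  fixes V W :: "('a \<Rightarrow> 'k::field) set"
  assumes "V \<subseteq> W" "fvs.subspace V" "fvs.subspace W" "W \<subseteq> fvs.span T" "finite T"
  obtains R S where "R \<subseteq> S" "finite S" "fvs.independent S" "fvs.span R = V" "fvs.span S = W"
    "fvs.dim V = card R" "fvs.dim W = card S"
proof -
  obtain R where R: "R \<subseteq> V" "fvs.independent R" "V \<subseteq> fvs.span R"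
    using fvs.maximal_independent_subset by blast
  obtain S where S: "R \<subseteq> S" "S \<subseteq> W" "fvs.independent S" "W \<subseteq> fvs.span S"
    using fvs.maximal_independent_subset_extend[of R W] R assms(1) by (metis subset_trans)
  have "finite S" using fvs.independent_span_bound[OF assms(5) S(3)] S(2) assms(4) by blast
  moreover have "fvs.span R = V" "fvs.span S = W"
    using R S assms fvs.span_minimal by (metis subset_antisym)+
  moreover have "fvs.dim V = card R" "fvs.dim W = card S"
    using fvs.dim_unique R S by blast+
  ultimately show ?thesis using that[of R S] S by blast
qed

lemma dim_subspace_le:
  fixes V W :: "('a \<Rightarrow> 'k::field) set"
  assumes "V \<subseteq> W" "fvs.subspace V" "fvs.subspace W" "W \<subseteq> fvs.span T" "finite T"
  shows "fvs.dim V \<le> fvs.dim W" "fvs.dim V = fvs.dim W \<Longrightarrow> W \<subseteq> V"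
proof -
  obtain R S where RS: "R \<subseteq> S" "finite S" "fvs.span R = V" "fvs.span S = W"
    "fvs.dim V = card R" "fvs.dim W = card S"
    using finite_basis_extension[OF assms] by metis
  show "fvs.dim V \<le> fvs.dim W" using RS card_mono by metis
  show "W \<subseteq> V" if "fvs.dim V = fvs.dim W" 
    using that RS card_subset_eq[of S R] by simp
qed

lemma dim_subspace_Suc:
  fixes V W :: "('a \<Rightarrow> 'k::field) set"
  assumes VW: "V \<subseteq> W" "fvs.subspace V" "fvs.subspace W" "W \<subseteq> fvs.span T" "finite T"
    and x: "x \<in> W" "x \<notin> V" "\<And>y. y \<in> W \<Longrightarrow> \<exists>c. y - smul c x \<in> V"
  shows "fvs.dim W = Suc (fvs.dim V)"
proof -
  obtain R S where RS: "R \<subseteq> S" "finite S" "fvs.independent S" "fvs.span R = V" "fvs.dim V = card R"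
    using finite_basis_extension[OF VW] by metis
  have fin: "finite R" using RS finite_subset by blast
  have xR: "x \<notin> R" using x(2) RS(4) fvs.span_base by blast
  have "fvs.independent (insert x R)"
    using fvs.independent_insertI[of x R] fvs.independent_mono[OF RS(3,1)] x(2) RS(4) by blast
  moreover have "insert x R \<subseteq> W" using x(1) VW(1) RS(4) fvs.span_superset by blast
  moreover have "W \<subseteq> fvs.span (insert x R)"
  proof
    fix y assume "y \<in> W"
    then obtain c where "y - smul c x \<in> fvs.span R" using x(3) RS(4) by blast
    then show "y \<in> fvs.span (insert x R)" unfolding fvs.span_insert by blast
  qed
  ultimately show ?thesis using fvs.dim_unique[of "insert x R" W "Suc (card R)"] fin xR RS(5) by simp
qed

lemma rank_nullity:
  fixes V :: "('a \<Rightarrow> 'k::field) set" and f :: "('a \<Rightarrow> 'k) \<Rightarrow> 'b \<Rightarrow> 'k"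
  assumes f: "Vector_Spaces.linear smul smul f"
    and V: "fvs.subspace V" "V \<subseteq> fvs.span T" "finite T"
  shows "fvs.dim V = fvs.dim {x \<in> V. f x = 0} + fvs.dim (f ` V)"
proof -
  interpret P: vector_space_pair "smul :: 'k \<Rightarrow> ('a \<Rightarrow> 'k) \<Rightarrow> 'a \<Rightarrow> 'k" "smul :: 'k \<Rightarrow> ('b \<Rightarrow> 'k) \<Rightarrow> 'b \<Rightarrow> 'k" ..
  have "fvs.subspace {x \<in> V. f x = 0}"
    using V(1) by (auto simp: fvs.subspace_def P.linear_add[OF f] P.linear_scale[OF f] P.linear_0[OF f])
  then obtain R S where RS: "R \<subseteq> S" "finite S" "fvs.independent S" "fvs.span R = {x \<in> V. f x = 0}" 
     "fvs.span S = V" "fvs.dim {x \<in> V. f x = 0} = card R" "fvs.dim V = card S"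
    using finite_basis_extension[of "{x \<in> V. f x = 0}" V T] V by (metis (no_types, lifting) mem_Collect_eq subsetI)
  have fin: "finite R" "finite (S - R)" using RS finite_subset by blast+
  \<comment> \<open>Such an x is a combination of R and also one of S - R; the difference is a
    relation on the independent set S.\<close>
  have "x = 0" if x: "x \<in> fvs.span (S - R)" and fx: "f x = 0" for x
  proof -
    have "x \<in> fvs.span R" using x fx RS(4,5) fvs.span_mono[of "S - R" S] by auto
    then obtain a where a: "x = (\<Sum>v\<in>R. smul (a v) v)" unfolding fvs.span_finite[OF fin(1)] by blast
    obtain b where b: "x = (\<Sum>v\<in>S - R. smul (b v) v)" using x unfolding fvs.span_finite[OF fin(2)] by blast
    let ?c = "\<lambda>v. if v \<in> R then a v else - b v"
    have "(\<Sum>v\<in>S. smul (?c v) v) = (\<Sum>v\<in>S - R. smul (?c v) v) + (\<Sum>v\<in>R. smul (?c v) v)"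
      using sum.subset_diff[OF RS(1,2)] by blast
    also have "(\<Sum>v\<in>R. smul (?c v) v) = x" unfolding a by (rule sum.cong) auto
    also have "(\<Sum>v\<in>S - R. smul (?c v) v) = (\<Sum>v\<in>S - R. - smul (b v) v)"
      by (rule sum.cong) auto
    also have "\<dots> = - x" unfolding b by (simp add: sum_negf)
    finally have "(\<Sum>v\<in>S. smul (?c v) v) = 0" by simp
    then have "?c v = 0" if "v \<in> S" for v using fvs.independentD[where u = ?c, OF RS(3,2) subset_refl _ that] by blast
    then have "a v = 0" if "v \<in> R" for v using that RS(1) by (metis subsetD)
    then show "x = 0" unfolding a by simp
  qed
  then have inj: "inj_on f (fvs.span (S - R))"
    by (subst P.linear_inj_on_iff_eq_0[OF f]) auto
  have "fvs.independent (f ` (S - R))"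
    using P.linear_independent_injective_image[OF f fvs.independent_mono[OF RS(3)] inj] by blast
  moreover have "f ` (S - R) \<subseteq> f ` V" using RS(5) fvs.span_superset by blast
  moreover have "f ` V \<subseteq> fvs.span (f ` (S - R))"
  proof -
    have "f v \<in> fvs.span (f ` (S - R))" if "v \<in> S" for v
    proof (cases "v \<in> R")
      case True
      then have "f v = 0" using RS(4) fvs.span_superset[of R] by blast
      then show ?thesis by (simp add: fvs.span_zero)
    next
      case False
      then show ?thesis using that by (intro fvs.span_base) auto
    qed
    then have "fvs.span (f ` S) \<subseteq> fvs.span (f ` (S - R))"
      by (intro fvs.span_minimal) auto
    then show ?thesis using P.linear_span_image[OF f, of S] RS(5) by simp
  qed
  moreover have "card (f ` (S - R)) = card S - card R"
    using inj_on_subset[OF inj fvs.span_superset] card_image card_Diff_subset[OF fin(1) RS(1)] by metis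
  ultimately have "fvs.dim (f ` V) = card S - card R" using fvs.dim_unique by blast
  then show ?thesis using RS(6,7) card_mono[OF RS(2,1)] by simp
qed

text \<open>The recursion \<open>chi_rec\<close> for a whole row at once, on lists so that type E
  can be settled by evaluation.\<close>

fun row_step :: "nat list list \<Rightarrow> int list \<Rightarrow> int list \<Rightarrow> int list" where
  "row_step nbs ys xs = map2 (\<lambda>us x. (\<Sum>u\<leftarrow>us. ys ! u) - x) nbs xs"

text \<open>Rows \<open>l\<close> and \<open>l + 1\<close> being \<open>xs\<close> and \<open>ys\<close>, row \<open>l + m + 1\<close> is the first zero row from row \<open>l\<close> on.\<close>
fun first_zero_row :: "nat list list \<Rightarrow> nat \<Rightarrow> int list \<Rightarrow> int list \<Rightarrow> bool" where
  "first_zero_row nbs 0 xs ys \<longleftrightarrow> list_ex (\<lambda>x. x \<noteq> 0) xs \<and> list_all (\<lambda>y. y = 0) ys"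
| "first_zero_row nbs (Suc m) xs ys \<longleftrightarrow>
     list_ex (\<lambda>x. x \<noteq> 0) xs \<and> first_zero_row nbs m ys (row_step nbs ys xs)"

locale dynkin_quiver =
  fixes t :: dynkin and eps :: "nat \<Rightarrow> nat \<Rightarrow> int"
  assumes valid: "dynkin_valid t"
    and eps: "\<forall>u v. adj t u v \<longrightarrow> eps u v \<in> {1, -1} \<and> eps v u = - eps u v"
begin

subsection \<open>The differential on word functions\<close>

abbreviation "d \<equiv> koszul_d t eps"

abbreviation e :: "nat \<Rightarrow> nat \<Rightarrow> 'k::field" where "e u v \<equiv> of_int (eps u v)"

lemma e_square: "adj t u v \<Longrightarrow> e u v * e u v = 1"
  using eps by fastforce

lemma adj_sym: "adj t u v \<longleftrightarrow> adj t v u"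
  by (auto simp: adj_def)

lemma adj_rank: "adj t u v \<Longrightarrow> u < rank t \<and> v < rank t"
  using valid by (cases t) (auto simp: adj_def)

lemma d_Nil [simp]: "d f [] = 0"
  by simp

lemma coef_d:
  "coef (Lp u) (d f) = - d (coef (Lp u) f)"
  "coef (Arr v u) (d f) = d (coef (Arr v u) f) +
     (if adj t u v then smul (e u v) (lmul (Arr u v) (coef (Lp u) f)) else 0)"
  by (auto simp: coef_def[of _ "d f"] fun_eq_iff fun_apply)

lemma d_linear_at:
  "d (0 :: letter list \<Rightarrow> 'k::field) w = 0"
  "d (f + g :: letter list \<Rightarrow> 'k) w = d f w + d g w" "d (smul c (f :: letter list \<Rightarrow> 'k)) w = c * d f w"
proof -
  show "d (0 :: letter list \<Rightarrow> 'k) w = 0"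
  proof (rule list.induct[of "\<lambda>w. d (0 :: letter list \<Rightarrow> 'k) w = 0"])
    fix a w assume "d (0 :: letter list \<Rightarrow> 'k) w = 0"
    then show "d (0 :: letter list \<Rightarrow> 'k) (a # w) = 0" 
      by (cases a) (auto simp: fun_apply)
  qed simp
  have "\<forall>f g :: letter list \<Rightarrow> 'k. d (f + g) w = d f w + d g w"
  proof (rule list.induct[of "\<lambda>w. \<forall>f g :: letter list \<Rightarrow> 'k. d (f + g) w = d f w + d g w"])
    fix a w assume IH: "\<forall>f g :: letter list \<Rightarrow> 'k. d (f + g) w = d f w + d g w"
    show "\<forall>f g :: letter list \<Rightarrow> 'k. d (f + g) (a # w) = d f (a # w) + d g (a # w)"
      using IH by (cases a) (auto simp: fun_apply algebra_simps)
  qed simp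
  then show "d (f + g :: letter list \<Rightarrow> 'k) w = d f w + d g w" by blast
  have "\<forall>f :: letter list \<Rightarrow> 'k. d (smul c f) w = c * d f w"
  proof (rule list.induct[of "\<lambda>w. \<forall>f :: letter list \<Rightarrow> 'k. d (smul c f) w = c * d f w"])
    fix a w assume IH: "\<forall>f :: letter list \<Rightarrow> 'k. d (smul c f) w = c * d f w"
    show "\<forall>f :: letter list \<Rightarrow> 'k. d (smul c f) (a # w) = c * d f (a # w)"
      using IH by (cases a) (auto simp: fun_apply algebra_simps)
  qed simp
  then show "d (smul c f) w = c * d f w" by blast
qed

lemma d_linear [simp]:
  "d 0 = 0" "d (f + g) = d f + d g" "d (smul c f) = smul c (d f)"
  by (auto simp: fun_eq_iff d_linear_at fun_apply)

lemma d_minus [simp]: "d (- f) = - d f"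
proof -
  have "d (- f) + d f = 0" using d_linear(2)[of "- f" f] by simp
  then show ?thesis by (simp add: eq_neg_iff_add_eq_0)
qed

lemma d_diff [simp]: "d (f - g) = d f - d g"
  using d_linear(2)[of f "- g"] by simp

lemma d_sum: "d (sum f S) = (\<Sum>x\<in>S. d (f x))"
  by (induction S rule: infinite_finite_induct) auto

lemma d_lmul_Arr [simp]: "d (lmul (Arr a b) f) = lmul (Arr a b) (d f)"
proof (rule word_fun_eqI)
  fix x show "coef x (d (lmul (Arr a b) f)) = coef x (lmul (Arr a b) (d f))"
    by (cases x) (auto simp: coef_d)
qed simp


lemma d_d [simp]: "d (d (f :: letter list \<Rightarrow> 'k::field)) = 0"
proof
  fix w
  have "\<forall>f :: letter list \<Rightarrow> 'k. d (d f) w = 0"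
  proof (rule list.induct[of "\<lambda>w. \<forall>f :: letter list \<Rightarrow> 'k. d (d f) w = 0"])
    fix a w assume IH: "\<forall>f :: letter list \<Rightarrow> 'k. d (d f) w = 0"
    show "\<forall>f :: letter list \<Rightarrow> 'k. d (d f) (a # w) = 0"
      using IH by (cases a) (auto simp: coef_d fun_apply)
  qed simp
  then show "d (d f) w = (0 :: letter list \<Rightarrow> 'k) w" by (simp add: fun_apply)
qed

section \<open>The graded pieces\<close>

definition words :: "nat \<Rightarrow> nat \<Rightarrow> int \<Rightarrow> int \<Rightarrow> letter list set" where
  "words i j l k = {w. word_from t i j w \<and> int (wlen w) = l \<and> int (nL w) = k}"

text \<open>Here k is minus the cohomological degree. Both gradings are integers, so that
  \<open>l - 2\<close> and \<open>k - 1\<close> may become negative, where the pieces vanish,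
  instead of being cut off at 0.\<close>

definition C :: "nat \<Rightarrow> nat \<Rightarrow> int \<Rightarrow> int \<Rightarrow> (letter list \<Rightarrow> 'k::field) set" where
  "C i j l k = {f. \<forall>w. f w \<noteq> 0 \<longrightarrow> w \<in> words i j l k}"

lemma word_from_Cons:
  "word_from t i j (a # w) \<longleftrightarrow> letter_ok t a \<and> ltgt a = j \<and> word_from t i (lsrc a) w"
proof (cases w)
  case Nil
  then show ?thesis
    by (cases a) (auto simp: word_from_def dest: adj_rank)
next
  case (Cons b w')
  have "(\<forall>p. Suc p < length (a # w) \<longrightarrow> lsrc ((a # w) ! p) = ltgt ((a # w) ! Suc p)) \<longleftrightarrow>
      lsrc a = ltgt b \<and> (\<forall>p. Suc p < length w \<longrightarrow> lsrc (w ! p) = ltgt (w ! Suc p))"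
    by (auto simp: Cons nth_Cons split: nat.splits)
  then show ?thesis
    unfolding word_from_def by (cases a; simp add: Cons; auto dest: adj_rank)
qed

lemma words_Nil: "[] \<in> words i j l k \<longleftrightarrow> i = j \<and> j < rank t \<and> l = 0 \<and> k = 0"
  by (auto simp: words_def word_from_def wlen_def nL_def)

lemma words_rank: "w \<in> words i j l k \<Longrightarrow> i < rank t \<and> j < rank t"
  by (auto simp: words_def word_from_def)

lemma words_Cons:
  "Arr v u # w \<in> words i j l k \<longleftrightarrow> u = j \<and> adj t v j \<and> w \<in> words i v (l - 1) k"
  "Lp u # w \<in> words i j l k \<longleftrightarrow> u = j \<and> w \<in> words i j (l - 2) (k - 1)"
proof -
  show "Lp u # w \<in> words i j l k \<longleftrightarrow> u = j \<and> w \<in> words i j (l - 2) (k - 1)"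
    using words_rank[of w i j "l - 2" "k - 1"]
    by (auto simp: words_def word_from_Cons wlen_def nL_def)
qed (auto simp: words_def word_from_Cons wlen_def nL_def)

lemma nL_le_wlen: "2 * nL w \<le> wlen w"
proof (induction w)
  case (Cons a w) then show ?case by (cases a) (auto simp: nL_def wlen_def)
qed (simp add: nL_def wlen_def)

lemma words_empty: "l < 0 \<or> k < 0 \<or> l < 2 * k \<Longrightarrow> words i j l k = {}"
proof -
  have "0 \<le> k \<and> 2 * k \<le> l" if "w \<in> words i j l k" for w
    using that nL_le_wlen[of w] by (auto simp: words_def)
  then show "l < 0 \<or> k < 0 \<or> l < 2 * k \<Longrightarrow> words i j l k = {}" by fastforce
qed

lemma C_zero [simp]: "0 \<in> C i j l k"
  by (simp add: C_def fun_apply)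

lemma C_subspace: "f \<in> C i j l k \<Longrightarrow> g \<in> C i j l k \<Longrightarrow> f + g \<in> C i j l k"
  "f \<in> C i j l k \<Longrightarrow> g \<in> C i j l k \<Longrightarrow> f - g \<in> C i j l k"
  "f \<in> C i j l k \<Longrightarrow> - f \<in> C i j l k"
  "f \<in> C i j l k \<Longrightarrow> smul c f \<in> C i j l k"
  unfolding C_def by (auto simp: fun_apply) (metis add_0 diff_0 diff_self neg_0_equal_iff_equal)+

lemma C_trivial: "l < 0 \<or> k < 0 \<or> l < 2 * k \<Longrightarrow> f \<in> C i j l k \<Longrightarrow> f = 0"
  using words_empty[of l k i j] by (auto simp: C_def fun_eq_iff fun_apply)

lemma C_coef:
  assumes "f \<in> C i j l k"
  shows "coef (Arr v j) f \<in> C i v (l - 1) k" "coef (Lp j) f \<in> C i j (l - 2) (k - 1)"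
    "u \<noteq> j \<or> \<not> adj t v j \<Longrightarrow> coef (Arr v u) f = 0" "u \<noteq> j \<Longrightarrow> coef (Lp u) f = 0"
  using assms by (auto simp: C_def coef_def words_Cons fun_eq_iff fun_apply)

lemma C_Nil: "f \<in> C i j l k \<Longrightarrow> l \<noteq> 0 \<or> i \<noteq> j \<or> k \<noteq> 0 \<Longrightarrow> f [] = 0"
  using words_Nil by (auto simp: C_def)

text \<open>An element of the cone given by its components: \<open>y v\<close> behind the arrow from
  \<open>v\<close> to \<open>j\<close>, and \<open>y'\<close> behind l_j.\<close>

definition asm :: "nat \<Rightarrow> (nat \<Rightarrow> letter list \<Rightarrow> 'k::field) \<Rightarrow> (letter list \<Rightarrow> 'k) \<Rightarrow> letter list \<Rightarrow> 'k" where
  "asm j y y' w = (case w of [] \<Rightarrow> 0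
     | Arr v u # w' \<Rightarrow> if u = j \<and> adj t v j then y v w' else 0
     | Lp u # w' \<Rightarrow> if u = j then y' w' else 0)"

lemma asm_simps [simp]:
  "asm j y y' [] = 0"
  "coef (Arr v u) (asm j y y') = (if u = j \<and> adj t v j then y v else 0)"
  "coef (Lp u) (asm j y y') = (if u = j then y' else 0)"
  by (auto simp: asm_def coef_def fun_eq_iff fun_apply)

lemma C_asm:
  assumes "\<And>v. adj t v j \<Longrightarrow> y v \<in> C i v (l - 1) k" and "y' \<in> C i j (l - 2) (k - 1)"
  shows "asm j y y' \<in> C i j l k"
proof -
  have "w \<in> words i j l k" if "asm j y y' w \<noteq> 0" for w
    using that assms 
    by (auto simp: asm_def C_def words_Cons split: list.splits letter.splits if_splits)
  then show ?thesis by (auto simp: C_def)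
qed

lemma C_eqI:
  assumes "f \<in> C i j l k" "g \<in> C i j l k" "l \<noteq> 0"
    and "\<And>v. adj t v j \<Longrightarrow> coef (Arr v j) f = coef (Arr v j) g"
    and "coef (Lp j) f = coef (Lp j) g"
  shows "f = g"
proof (rule word_fun_eqI)
  show "f [] = g []" using assms by (simp add: C_Nil)
  fix a show "coef a f = coef a g"
    using assms C_coef(3,4)[OF assms(1)] C_coef(3,4)[OF assms(2)] by (cases a) metis+
qed

lemma C_lmul_Arr: "f \<in> C i v (l - 1) k \<Longrightarrow> adj t v j \<Longrightarrow> lmul (Arr v j) f \<in> C i j l k"
  by (auto simp: C_def lmul_def words_Cons split: list.splits if_splits)

lemma C_lmul_Lp: "f \<in> C i j (l - 2) (k - 1) \<Longrightarrow> lmul (Lp j) f \<in> C i j l k"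
  by (auto simp: C_def lmul_def words_Cons split: list.splits if_splits)

lemma C_d: 
  assumes "f \<in> C i j l k" shows "d f \<in> C i j l (k - 1)"
proof -
  have "\<forall>j l k. \<forall>f \<in> C i j l k. d (f :: letter list \<Rightarrow> 'k::field) w \<noteq> 0 \<longrightarrow> w \<in> words i j l (k - 1)" for w
  proof (rule list.induct[of "\<lambda>w. \<forall>j l k. \<forall>f \<in> C i j l k. d (f :: letter list \<Rightarrow> 'k::field) w \<noteq> 0 \<longrightarrow> w \<in> words i j l (k - 1)"])
    fix a w
    assume IH: "\<forall>j l k. \<forall>f \<in> C i j l k. d (f :: letter list \<Rightarrow> 'k) w \<noteq> 0 \<longrightarrow> w \<in> words i j l (k - 1)"
    have "a # w \<in> words i j l (k - 1)"
      if f: "f \<in> C i j l k" and nz: "d (f :: letter list \<Rightarrow> 'k) (a # w) \<noteq> 0" for j l k f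
    proof (cases a)
      case (Lp u)
      then have nz': "d (coef (Lp u) f) w \<noteq> 0" using nz by simp
      then have "u = j" using C_coef(4)[OF f, of u] by (metis d_linear(1) zero_fun_apply)
      moreover have "w \<in> words i j (l - 2) (k - 1 - 1)"
        using IH C_coef(2)[OF f] nz' calculation by blast
      ultimately show ?thesis by (simp add: Lp words_Cons)
    next
      case (Arr v u)
      have uj: "u = j \<and> adj t v j"
      proof (rule ccontr)
        assume n: "\<not> ?thesis"
        then have "coef (Arr v u) f = 0" using C_coef(3)[OF f] by blast
        moreover have "adj t u v \<Longrightarrow> coef (Lp u) f = 0"
          using n C_coef(4)[OF f, of u] adj_sym[of u v] by auto
        ultimately show False using nz Arr by (cases "adj t u v") (auto simp: fun_apply)
      qed
      \<comment> \<open>The contribution of theta_j: l_j is traded for two arrows, which keeps the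
        length and loses one letter l.\<close>
      have "lmul (Arr j v) (coef (Lp j) f) \<in> C i v (l - 1) (k - 1)"
        using uj C_coef(2)[OF f] adj_sym
        by (intro C_lmul_Arr) (auto simp: algebra_simps)
      then have "lmul (Arr j v) (coef (Lp j) f) w \<noteq> 0 \<Longrightarrow> w \<in> words i v (l - 1) (k - 1)"
        unfolding C_def by auto
      moreover have "d (coef (Arr v j) f) w \<noteq> 0 \<Longrightarrow> w \<in> words i v (l - 1) (k - 1)"
        using IH C_coef(1)[OF f] by blast
      ultimately show ?thesis
        using nz Arr uj by (cases "d (coef (Arr v j) f) w = 0") (auto simp: words_Cons split: if_splits)
    qed
    then show "\<forall>j l k. \<forall>f \<in> C i j l k. d (f :: letter list \<Rightarrow> 'k) (a # w) \<noteq> 0 \<longrightarrow> a # w \<in> words i j l (k - 1)"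
      by blast
  qed simp
  then have "\<forall>w. d f w \<noteq> 0 \<longrightarrow> w \<in> words i j l (k - 1)"
    using assms by blast
  then show ?thesis by (simp add: C_def)
qed

subsection \<open>Cones and right multiplication by a cocycle\<close>

definition B :: "nat \<Rightarrow> nat \<Rightarrow> int \<Rightarrow> int \<Rightarrow> (letter list \<Rightarrow> 'k::field) set" where
  "B i j l k = d ` C i j l (k + 1)"

definition Z :: "nat \<Rightarrow> nat \<Rightarrow> int \<Rightarrow> int \<Rightarrow> (letter list \<Rightarrow> 'k::field) set" where
  "Z i j l k = {f \<in> C i j l k. d f = 0}"

lemma C_d': "f \<in> C i j l (k + 1) \<Longrightarrow> d f \<in> C i j l k"
  using C_d[of f i j l "k + 1"] by simp

lemma B_sub_Z: "f \<in> B i j l k \<Longrightarrow> f \<in> Z i j l k"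
  by (auto simp: B_def Z_def C_d')

lemma Z_sub_C: "f \<in> Z i j l k \<Longrightarrow> f \<in> C i j l k"
  by (auto simp: Z_def)

lemma B_sub_C: "f \<in> B i j l k \<Longrightarrow> f \<in> C i j l k"
  by (auto simp: B_def C_d')

lemma B_zero [simp]: "0 \<in> B i j l k"
  unfolding B_def by (rule image_eqI[of _ _ 0]) auto

lemma B_subspace: "f \<in> B i j l k \<Longrightarrow> g \<in> B i j l k \<Longrightarrow> f + g \<in> B i j l k"
  "f \<in> B i j l k \<Longrightarrow> g \<in> B i j l k \<Longrightarrow> f - g \<in> B i j l k"
  "f \<in> B i j l k \<Longrightarrow> - f \<in> B i j l k"
  "f \<in> B i j l k \<Longrightarrow> smul c f \<in> B i j l k"
  unfolding B_def image_iff
  by (metis C_subspace(1) d_linear(2), metis C_subspace(2) d_diff,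
      metis C_subspace(3) d_minus, metis C_subspace(4) d_linear(3))

lemma Z_subspace: "f \<in> Z i j l k \<Longrightarrow> g \<in> Z i j l k \<Longrightarrow> f + g \<in> Z i j l k"
  "f \<in> Z i j l k \<Longrightarrow> g \<in> Z i j l k \<Longrightarrow> f - g \<in> Z i j l k"
  "f \<in> Z i j l k \<Longrightarrow> - f \<in> Z i j l k"
  "f \<in> Z i j l k \<Longrightarrow> smul c f \<in> Z i j l k"
  unfolding Z_def by (auto intro: C_subspace)

lemma smul_smul_e: "adj t u v \<Longrightarrow> smul (e u v) (smul (e u v) f) = f"
  by (simp add: e_square)

text \<open>A component of left multiplication by theta_j: theta_j f is the sum of
  \<open>lmul (Arr v j) (twist j v f)\<close> over the neighbours v.\<close>

definition twist :: "nat \<Rightarrow> nat \<Rightarrow> (letter list \<Rightarrow> 'k::field) \<Rightarrow> letter list \<Rightarrow> 'k" where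
  "twist j v f = smul (e j v) (lmul (Arr j v) f)"

lemma twist_linear [simp]:
  "twist j v (f + g) = twist j v f + twist j v g" "twist j v (f - g) = twist j v f - twist j v g"
  "twist j v (- f) = - twist j v f" "twist j v 0 = 0"
  "twist j v (smul c f) = smul c (twist j v f)" "d (twist j v f) = twist j v (d f)"
  by (simp_all add: twist_def fvs.scale_right_distrib fvs.scale_right_diff_distrib mult.commute)

lemma C_twist: "f \<in> C i j (l - 2) k \<Longrightarrow> adj t j v \<Longrightarrow> twist j v f \<in> C i v (l - 1) k"
  unfolding twist_def by (intro C_subspace C_lmul_Arr) (auto simp: algebra_simps)

lemma coef_d_at:
  "coef (Lp j) (d f) = - d (coef (Lp j) f)"
  "adj t v j \<Longrightarrow> coef (Arr v j) (d f) = d (coef (Arr v j) f) + twist j v (coef (Lp j) f)"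
  using adj_sym by (auto simp: coef_d twist_def)

lemma Z_coef:
  assumes "f \<in> Z i j l k"
  shows "coef (Lp j) f \<in> Z i j (l - 2) (k - 1)"
    and "adj t v j \<Longrightarrow> d (coef (Arr v j) f) = - twist j v (coef (Lp j) f)"
proof -
  have f: "f \<in> C i j l k" "d f = 0" using assms by (auto simp: Z_def)
  show "coef (Lp j) f \<in> Z i j (l - 2) (k - 1)"
    using C_coef(2)[OF f(1)] coef_d_at(1)[of j f] f(2) by (simp add: Z_def)
  show "adj t v j \<Longrightarrow> d (coef (Arr v j) f) = - twist j v (coef (Lp j) f)"
    using coef_d_at(2)[of v j f] f(2) by (simp add: eq_neg_iff_add_eq_0)
qed

text \<open>\<^term>\<open>C i j l\<close> is the cone of left multiplication by \<open>\<theta>\<^sub>j\<close>, from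
  \<^term>\<open>C i j (l - 2)\<close> to the sum of the \<^term>\<open>C i v (l - 1)\<close> over the neighbours \<open>v\<close> of \<open>j\<close>;
  this is a part of its long exact sequence.\<close>
lemma cone_boundary:
  fixes f :: "letter list \<Rightarrow> 'k::field"
  assumes f: "f \<in> Z i j l k" and l: "l \<noteq> 0"
    and ac: "\<And>v. adj t v j \<Longrightarrow> (Z i v (l - 1) k :: (letter list \<Rightarrow> 'k) set) \<subseteq> B i v (l - 1) k"
    and b: "coef (Lp j) f \<in> B i j (l - 2) (k - 1)"
  shows "f \<in> B i j l k"
proof -
  obtain g' where g': "g' \<in> C i j (l - 2) k" "coef (Lp j) f = d g'"
    using b by (auto simp: B_def)
  \<comment> \<open>Since f is closed, its arrow component has differential
    \<open>- twist j v (d g')\<close>; adding the twist of the primitive g' makes it closed. Below,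
    g' enters with a minus sign because d changes sign in passing l_j.\<close>
  have "\<exists>y \<in> C i v (l - 1) (k + 1). coef (Arr v j) f + twist j v g' = d y" if v: "adj t v j" for v
  proof -
    have "coef (Arr v j) f + twist j v g' \<in> Z i v (l - 1) k"
      using Z_coef(2)[OF f v] g' C_coef(1)[OF Z_sub_C[OF f]] C_twist[OF g'(1)] v adj_sym[of v j]
      by (auto simp: Z_def intro!: C_subspace)
    then show ?thesis using ac[OF v] unfolding B_def by blast
  qed
  then obtain y where y: "\<And>v. adj t v j \<Longrightarrow> y v \<in> C i v (l - 1) (k + 1)"
    "\<And>v. adj t v j \<Longrightarrow> coef (Arr v j) f + twist j v g' = d (y v)" by metis
  have "asm j y (- g') \<in> C i j l (k + 1)"
    using y(1) g'(1) by (intro C_asm C_subspace) auto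
  moreover from this have "d (asm j y (- g')) = f"
    using f l y(2) g'(2)
    by (intro C_eqI[OF C_d' Z_sub_C[OF f]]) (auto simp: coef_d_at simp flip: y(2))
  ultimately show ?thesis by (auto simp: B_def)
qed

text \<open>The product f z: the value at a word is the sum over all its cuts into a left part for f
  and a right part for z.\<close>

fun rmul :: "(letter list \<Rightarrow> 'k::field) \<Rightarrow> (letter list \<Rightarrow> 'k) \<Rightarrow> letter list \<Rightarrow> 'k" where
  "rmul z f [] = f [] * z []"
| "rmul z f (a # w) = f [] * z (a # w) + rmul z (coef a f) w"

lemma coef_rmul: "coef a (rmul z f) = smul (f []) (coef a z) + rmul z (coef a f)"
  by (auto simp: coef_def[of a "rmul z f"] coef_def[of a z] fun_eq_iff smul_simps fun_apply)

lemma rmul_linear [simp]: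
  "rmul z 0 = 0" "rmul z (f + g) = rmul z f + rmul z g" "rmul z (smul c f) = smul c (rmul z f)"
proof -
  have 1: "\<forall>f g :: letter list \<Rightarrow> 'a. rmul z (f + g) w = rmul z f w + rmul z g w" for w
  proof (rule list.induct[of "\<lambda>w. \<forall>f g :: letter list \<Rightarrow> 'a. rmul z (f + g) w = rmul z f w + rmul z g w"])
    fix a w assume IH: "\<forall>f g :: letter list \<Rightarrow> 'a. rmul z (f + g) w = rmul z f w + rmul z g w"
    show "\<forall>f g :: letter list \<Rightarrow> 'a. rmul z (f + g) (a # w) = rmul z f (a # w) + rmul z g (a # w)"
      using IH by (auto simp: fun_apply algebra_simps)
  qed (simp add: fun_apply algebra_simps)
  have 2: "\<forall>f :: letter list \<Rightarrow> 'a. rmul z (smul c f) w = c * rmul z f w" for w c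
  proof (rule list.induct[of "\<lambda>w. \<forall>f :: letter list \<Rightarrow> 'a. rmul z (smul c f) w = c * rmul z f w"])
    fix a w assume IH: "\<forall>f :: letter list \<Rightarrow> 'a. rmul z (smul c f) w = c * rmul z f w"
    show "\<forall>f :: letter list \<Rightarrow> 'a. rmul z (smul c f) (a # w) = c * rmul z f (a # w)"
      using IH by (auto simp: fun_apply algebra_simps)
  qed (simp add: fun_apply algebra_simps)
  show "rmul z (f + g) = rmul z f + rmul z g" using 1 by (auto simp: fun_apply)
  show "rmul z (smul c f) = smul c (rmul z f)" using 2 by (auto simp: fun_apply)
  show "rmul z 0 = 0" using 2[of 0] by (metis fvs.scale_zero_left smul_simps mult_zero_left zero_fun_apply ext)
qed

lemma rmul_minus [simp]: "rmul z (- f) = - rmul z f"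
proof -
  have "rmul z (- f) + rmul z f = 0" using rmul_linear(2)[of z "- f" f] by simp
  then show ?thesis by (simp add: eq_neg_iff_add_eq_0)
qed

lemma rmul_diff [simp]: "rmul z (f - g) = rmul z f - rmul z g"
  using rmul_linear(2)[of z f "- g"] by simp

lemma rmul_lmul [simp]: "rmul z (lmul a f) = lmul a (rmul z f)"
  by (rule word_fun_eqI) (auto simp: coef_rmul)

lemma rmul_twist [simp]: "rmul z (twist j v f) = twist j v (rmul z f)"
  by (simp add: twist_def)

text \<open>The signs in d count letters l to the left only, so a closed right factor produces no
  sign and no further term.\<close>

lemma d_rmul:
  assumes "d z = 0"
  shows "d (rmul z f) = rmul z (d f)"
proof
  fix w
  have "\<forall>f :: letter list \<Rightarrow> 'a. d (rmul z f) w = rmul z (d f) w"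
  proof (rule list.induct[of "\<lambda>w. \<forall>f :: letter list \<Rightarrow> 'a. d (rmul z f) w = rmul z (d f) w"])
    fix a w assume IH: "\<forall>f :: letter list \<Rightarrow> 'a. d (rmul z f) w = rmul z (d f) w"
    \<comment> \<open>The equation \<open>d z = 0\<close> letter by letter. It is needed where the
      cut falls before the first letter, that is, for the term with \<open>f []\<close>.\<close>
    have z: "d (coef (Lp u) z) = 0" 
      "d (coef (Arr v u) z) = - (if adj t u v then smul (e u v) (lmul (Arr u v) (coef (Lp u) z)) else 0)" for u v
      using coef_d(1)[of u z] coef_d(2)[of v u z] assms 
      by (auto simp: eq_neg_iff_add_eq_0)
    show "\<forall>f :: letter list \<Rightarrow> 'a. d (rmul z f) (a # w) = rmul z (d f) (a # w)"
      using IH by (cases a) (auto simp: coef_d coef_rmul z fun_apply algebra_simps)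
  qed simp
  then show "d (rmul z f) w = rmul z (d f) w" by blast
qed

lemma C_rmul:
  assumes z: "z \<in> C i i' q p" and f: "f \<in> C i' j l k"
  shows "rmul z f \<in> C i j (l + q) (k + p)"
proof -
  have "\<forall>j l k. \<forall>f \<in> C i' j l k. rmul z f w \<noteq> 0 \<longrightarrow> w \<in> words i j (l + q) (k + p)" for w
  proof (rule list.induct[of "\<lambda>w. \<forall>j l k. \<forall>f \<in> C i' j l k. rmul z f w \<noteq> 0 \<longrightarrow> w \<in> words i j (l + q) (k + p)"])
    have "[] \<in> words i j (l + q) (k + p)" if "f \<in> C i' j l k" "f [] * z [] \<noteq> 0" for j l k f
    proof -
      have "[] \<in> words i i' q p" "[] \<in> words i' j l k" using that z by (auto simp: C_def)
      then show ?thesis by (auto simp: words_Nil)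
    qed
    then show "\<forall>j l k. \<forall>f \<in> C i' j l k. rmul z f [] \<noteq> 0 \<longrightarrow> [] \<in> words i j (l + q) (k + p)" by auto
    fix a w
    assume IH: "\<forall>j l k. \<forall>f \<in> C i' j l k. rmul z f w \<noteq> 0 \<longrightarrow> w \<in> words i j (l + q) (k + p)"
    have "a # w \<in> words i j (l + q) (k + p)"
      if f: "f \<in> C i' j l k" and nz: "rmul z f (a # w) \<noteq> 0" for j l k f
    proof (cases "f [] * z (a # w) = 0")
      case False
      then have "[] \<in> words i' j l k" "a # w \<in> words i i' q p" using f z by (auto simp: C_def)
      then show ?thesis by (auto simp: words_Nil)
    next
      case True
      then have nz': "rmul z (coef a f) w \<noteq> 0" using nz by auto
      then have c: "coef a f \<noteq> 0" by (auto simp: fun_apply)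
      show ?thesis
      proof (cases a)
        case (Lp u)
        then have u: "u = j" using C_coef(4)[OF f, of u] c by auto
        have "w \<in> words i j (l - 2 + q) (k - 1 + p)"
          using IH C_coef(2)[OF f] nz' Lp u by blast
        then show ?thesis by (simp add: Lp words_Cons u algebra_simps)
      next
        case (Arr v u)
        then have u: "u = j \<and> adj t v j" using C_coef(3)[OF f, of u v] c by auto
        have "w \<in> words i v (l - 1 + q) (k + p)"
          using IH C_coef(1)[OF f] nz' Arr u by blast
        then show ?thesis by (simp add: Arr words_Cons u algebra_simps)
      qed
    qed
    then show "\<forall>j l k. \<forall>f \<in> C i' j l k. rmul z f (a # w) \<noteq> 0 \<longrightarrow> a # w \<in> words i j (l + q) (k + p)"
      by blast
  qed
  then have "\<forall>w. rmul z f w \<noteq> 0 \<longrightarrow> w \<in> words i j (l + q) (k + p)"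
    using f by blast
  then show ?thesis by (simp add: C_def)
qed

text \<open>All j and k are quantified together because the induction on l passes from j to its
  neighbours and from k to k - 1.\<close>

definition rmul_qis :: "(letter list \<Rightarrow> 'k::field) \<Rightarrow> nat \<Rightarrow> nat \<Rightarrow> int \<Rightarrow> int \<Rightarrow> int \<Rightarrow> bool" where
  "rmul_qis z i i' q p l \<longleftrightarrow> (\<forall>j k.
     (\<forall>f \<in> Z i j (l + q) (k + p). \<exists>x \<in> Z i' j l k. f - rmul z x \<in> B i j (l + q) (k + p)) \<and>
     (\<forall>x \<in> Z i' j l k. rmul z x \<in> B i j (l + q) (k + p) \<longrightarrow> x \<in> B i' j l k))"

lemma rmul_qis_surj:
  assumes "rmul_qis z i i' q p l" and "f \<in> Z i j (l + q) (k + p)"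
  obtains x g where "x \<in> Z i' j l k" "g \<in> C i j (l + q) (k + p + 1)" "f = rmul z x + d g"
proof -
  obtain x where "x \<in> Z i' j l k" "f - rmul z x \<in> B i j (l + q) (k + p)"
    using assms unfolding rmul_qis_def by blast
  then show ?thesis using that unfolding B_def by (auto simp: algebra_simps)
qed

lemma rmul_qis_inj:
  assumes "rmul_qis z i i' q p l" and "x \<in> Z i' j l k" "rmul z x = d g" "g \<in> C i j (l + q) (k + p + 1)"
  obtains y where "y \<in> C i' j l (k + 1)" "x = d y"
  using assms that unfolding rmul_qis_def B_def by blast

text \<open>Right multiplication commutes with \<open>twist\<close> and so is a map of cones;
  \<open>Q2\<close> covers the component behind l_j and \<open>Q1\<close> those behind the arrows.
  Surjectivity needs both surjectivities and the injectivity in \<open>Q1\<close>; injectivity needs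
  both injectivities and the surjectivity in \<open>Q2\<close>.\<close>

lemma rmul_qis_step:
  assumes z: "z \<in> Z i i' q p" and l: "l > 0" and q: "q \<ge> 0"
    and Q1: "rmul_qis z i i' q p (l - 1)" and Q2: "rmul_qis z i i' q p (l - 2)"
  shows "rmul_qis z i i' q p l"
  unfolding rmul_qis_def
proof (intro allI conjI ballI impI)
  have zC: "z \<in> C i i' q p" and dz: "d z = 0" using z by (auto simp: Z_def)
  fix j k
  {
    fix f :: "letter list \<Rightarrow> 'a" assume f: "f \<in> Z i j (l + q) (k + p)"
    let ?fL = "coef (Lp j) f"
    have "?fL \<in> Z i j (l - 2 + q) (k - 1 + p)"
      using Z_coef(1)[OF f] by (simp add: algebra_simps)
    then obtain xL gL where xL: "xL \<in> Z i' j (l - 2) (k - 1)" 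
      and gL: "gL \<in> C i j (l - 2 + q) (k - 1 + p + 1)" and fL: "?fL = rmul z xL + d gL"
      by (rule rmul_qis_surj[OF Q2])
    have xLC: "xL \<in> C i' j (l - 2) (k - 1)" and dxL: "d xL = 0" using xL by (auto simp: Z_def)
    have "\<exists>y g. y \<in> C i' v (l - 1) k \<and> g \<in> C i v (l + q - 1) (k + p + 1) \<and> d y = - twist j v xL
        \<and> coef (Arr v j) f = rmul z y - twist j v gL + d g" if v: "adj t v j" for v
    proof -
      have jv: "adj t j v" using v adj_sym by blast
      let ?f = "coef (Arr v j) f"
      have fC: "?f \<in> C i v (l - 1 + q) (k + p)"
        using C_coef(1)[OF Z_sub_C[OF f]] by (simp add: algebra_simps)
      have tg: "twist j v gL \<in> C i v (l - 1 + q) (k + p)"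
        using C_twist[of gL i j "l + q" "k + p" v] gL jv by (simp add: algebra_simps)
      \<comment> \<open>To extend the lift xL to a cocycle of the cone, its twists must be exact.
        They are exact after multiplication by z, hence before it by injectivity.\<close>
      have eq1: "rmul z (twist j v xL) = d (- (?f + twist j v gL))"
        using Z_coef(2)[OF f v] fL by simp
      have tx: "twist j v xL \<in> Z i' v (l - 1) (k - 1)"
        using C_twist[OF xLC jv] dxL by (simp add: Z_def)
      have "- (?f + twist j v gL) \<in> C i v (l - 1 + q) (k - 1 + p + 1)"
        using C_subspace(3)[OF C_subspace(1)[OF fC tg]] by (simp add: algebra_simps)
      then obtain y where y: "y \<in> C i' v (l - 1) (k - 1 + 1)" "twist j v xL = d y"
        by (rule rmul_qis_inj[OF Q1 tx eq1])
      have y1: "y \<in> C i' v (l - 1) k" using y(1) by simp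
      have "?f + twist j v gL + rmul z y \<in> C i v (l - 1 + q) (k + p)"
        by (intro C_subspace fC tg C_rmul[OF zC y1])
      moreover have "d (?f + twist j v gL + rmul z y) = 0"
        using Z_coef(2)[OF f v] fL rmul_twist[of z j v xL] unfolding y(2) by (simp add: d_rmul[OF dz])
      ultimately have "?f + twist j v gL + rmul z y \<in> Z i v (l - 1 + q) (k + p)"
        by (simp add: Z_def)
      then obtain x g where x: "x \<in> Z i' v (l - 1) k" and g: "g \<in> C i v (l - 1 + q) (k + p + 1)"
        and eq: "?f + twist j v gL + rmul z y = rmul z x + d g"
        by (rule rmul_qis_surj[OF Q1])
      have "?f = rmul z (x - y) - twist j v gL + d g" using eq by (simp add: algebra_simps) 
      moreover have "x - y \<in> C i' v (l - 1) k" using C_subspace(2)[OF Z_sub_C[OF x] y1] .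
      moreover have "d (x - y) = - twist j v xL" using x y by (simp add: Z_def)
      moreover have "g \<in> C i v (l + q - 1) (k + p + 1)" using g by (simp add: algebra_simps)
      ultimately show ?thesis by blast
    qed
    then obtain y g where yg: "\<And>v. adj t v j \<Longrightarrow> y v \<in> C i' v (l - 1) k \<and> g v \<in> C i v (l + q - 1) (k + p + 1) 
        \<and> d (y v) = - twist j v xL \<and> coef (Arr v j) f = rmul z (y v) - twist j v gL + d (g v)"
      by metis
    let ?x = "asm j y xL" and ?g = "asm j g (- gL)"
    have xC: "?x \<in> C i' j l k" using yg xLC by (intro C_asm) auto
    have gC: "?g \<in> C i j (l + q) (k + p + 1)"
      using yg gL by (intro C_asm C_subspace) (auto simp: algebra_simps)
    have "d ?x = 0"
      using l yg dxL by (intro C_eqI[OF C_d[OF xC] C_zero]) (auto simp: coef_d_at)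
    then have x: "?x \<in> Z i' j l k" using xC by (simp add: Z_def)
    have "f = rmul z ?x + d ?g"
    proof (rule C_eqI[OF Z_sub_C[OF f]])
      show "rmul z ?x + d ?g \<in> C i j (l + q) (k + p)"
        using C_rmul[OF zC xC] C_d'[OF gC] by (intro C_subspace)
      show "l + q \<noteq> 0" using l q by simp
      show "coef (Lp j) f = coef (Lp j) (rmul z ?x + d ?g)"
        using fL by (simp add: coef_rmul coef_d_at)
      show "coef (Arr v j) f = coef (Arr v j) (rmul z ?x + d ?g)" if "adj t v j" for v
        using yg[OF that] that by (simp add: coef_rmul coef_d_at)
    qed
    then have "f - rmul z ?x = d ?g" by simp
    then show "\<exists>x\<in>Z i' j l k. f - rmul z x \<in> B i j (l + q) (k + p)"
      using x gC unfolding B_def by (metis image_eqI)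
  }
  {
    fix x :: "letter list \<Rightarrow> 'a" assume x: "x \<in> Z i' j l k" and xB: "rmul z x \<in> B i j (l + q) (k + p)"
    obtain g where g: "g \<in> C i j (l + q) (k + p + 1)" "rmul z x = d g"
      using xB by (auto simp: B_def)
    have x0: "x [] = 0" using C_Nil[OF Z_sub_C[OF x]] l by simp
    let ?gL = "coef (Lp j) g" and ?xL = "coef (Lp j) x"
    have gL: "?gL \<in> C i j (l - 2 + q) (k + p)" using C_coef(2)[OF g(1)] by (simp add: algebra_simps)
    have e1: "rmul z ?xL = d (- ?gL)"
      using arg_cong[OF g(2), of "coef (Lp j)"] x0 by (simp add: coef_rmul coef_d_at)
    have xLZ: "?xL \<in> Z i' j (l - 2) (k - 1)" by (rule Z_coef(1)[OF x])
    obtain y0 where y0: "y0 \<in> C i' j (l - 2) (k - 1 + 1)" "?xL = d y0"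
      using rmul_qis_inj[OF Q2 xLZ e1] gL C_subspace(3)[OF gL] by (auto simp: algebra_simps)
    have "?gL + rmul z y0 \<in> Z i j (l - 2 + q) (k + p)"
      using gL y0 e1 C_rmul[OF zC, of y0 j "l - 2" k] by (auto simp: Z_def d_rmul[OF dz] intro!: C_subspace)
    then obtain u r where u: "u \<in> Z i' j (l - 2) k" and r: "r \<in> C i j (l - 2 + q) (k + p + 1)"
      and eq: "?gL + rmul z y0 = rmul z u + d r"
      by (rule rmul_qis_surj[OF Q2])
    \<comment> \<open>The primitive y0 of \<open>?xL\<close> is only determined up to cocycles; u
      adjusts it so that its image matches \<open>?gL\<close> up to a boundary. Without this the
      arrow components below would not become exact.\<close>
    define yL where "yL = u - y0"
    have yL: "yL \<in> C i' j (l - 2) k" "?xL = - d yL" "?gL = rmul z yL + d r"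
      using u y0 eq C_subspace(2)[of u i' j "l - 2" k y0] by (auto simp: yL_def Z_def algebra_simps)
    have "\<exists>y \<in> C i' v (l - 1) (k + 1). coef (Arr v j) x - twist j v yL = d y" if v: "adj t v j" for v
    proof -
      have jv: "adj t j v" using v adj_sym by blast
      have Z1: "coef (Arr v j) x - twist j v yL \<in> Z i' v (l - 1) k"
        using Z_coef(2)[OF x v] yL C_coef(1)[OF Z_sub_C[OF x]] C_twist[OF yL(1) jv]
        by (auto simp: Z_def intro!: C_subspace)
      have "rmul z (coef (Arr v j) x) = d (coef (Arr v j) g) + twist j v ?gL"
        using arg_cong[OF g(2), of "coef (Arr v j)"] x0 v by (simp add: coef_rmul coef_d_at)
      then have "rmul z (coef (Arr v j) x - twist j v yL) = d (coef (Arr v j) g + twist j v r)"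
        using yL(3) by simp
      moreover have "coef (Arr v j) g + twist j v r \<in> C i v (l - 1 + q) (k + p + 1)"
        using C_coef(1)[OF g(1)] C_twist[of r i j "l + q" "k + p + 1" v] r jv
        by (auto intro!: C_subspace simp: algebra_simps)
      ultimately show ?thesis using rmul_qis_inj[OF Q1 Z1] by blast
    qed
    then obtain y where y: "\<And>v. adj t v j \<Longrightarrow> y v \<in> C i' v (l - 1) (k + 1)"
      "\<And>v. adj t v j \<Longrightarrow> coef (Arr v j) x - twist j v yL = d (y v)" by metis
    have yC: "asm j y yL \<in> C i' j l (k + 1)" using y yL by (intro C_asm) auto
    have "x = d (asm j y yL)"
      using l y(2) yL(2) by (intro C_eqI[OF Z_sub_C[OF x] C_d'[OF yC]]) (auto simp: coef_d_at simp flip: y(2))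
    then show "x \<in> B i' j l k" using yC by (auto simp: B_def)
  }
qed

text \<open>Each step looks back at two lengths, so the induction starts at -1 and 0.\<close>

lemma rmul_qis_all:
  assumes z: "z \<in> Z i i' q p" and q: "q \<ge> 0"
    and Q0: "rmul_qis z i i' q p (- 1)" and Q1: "rmul_qis z i i' q p 0"
  shows "rmul_qis z i i' q p (int l)"
proof -
  have "rmul_qis z i i' q p (int l - 1) \<and> rmul_qis z i i' q p (int l)"
  proof (induction l)
    case (Suc l)
    then show ?case
      using rmul_qis_step[OF z _ q, of "int (Suc l)"] by (simp add: algebra_simps)
  qed (use Q0 Q1 in simp)
  then show ?thesis by simp
qed

subsection \<open>Bricks\<close>

lemma B_subspace': "fvs.subspace (B i j l k)"
  by (auto simp: fvs.subspace_def intro: B_subspace)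

lemma C_subspace': "fvs.subspace (C i j l k)"
  by (auto simp: fvs.subspace_def intro: C_subspace)

lemma finite_words: "finite (words i j l k)"
proof (rule finite_subset)
  let ?L = "case_prod Arr ` ({..<rank t} \<times> {..<rank t}) \<union> Lp ` {..<rank t}"
  show "words i j l k \<subseteq> {w. set w \<subseteq> ?L \<and> length w \<le> nat l}"
  proof (rule subsetI, rule CollectI, rule conjI)
    fix w assume w: "w \<in> words i j l k"
    have "x \<in> ?L" if "x \<in> set w" for x
    proof -
      have "letter_ok t x" using w that by (auto simp: words_def word_from_def)
      then show ?thesis by (cases x) (auto dest: adj_rank)
    qed
    then show "set w \<subseteq> ?L" by blast
    have "length w \<le> wlen w" for w
    proof (induction w)
      case (Cons a w) then show ?case by (cases a) (auto simp: wlen_def)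
    qed (simp add: wlen_def)
    from this[of w] show "length w \<le> nat l" using w by (auto simp: words_def)
  qed
  show "finite {w. set w \<subseteq> ?L \<and> length w \<le> nat l}"
    by (rule finite_lists_length_le) auto
qed

definition nb :: "nat \<Rightarrow> nat set" where "nb v = {u. adj t u v}"

lemma finite_nb [simp]: "finite (nb v)"
  by (rule finite_subset[of _ "{..<rank t}"]) (auto simp: nb_def dest: adj_rank)

definition single :: "letter list \<Rightarrow> letter list \<Rightarrow> 'k::field" where
  "single w = (\<lambda>w'. if w' = w then 1 else 0)"

lemma C_single: "w \<in> words i j l k \<Longrightarrow> single w \<in> C i j l k"
  by (auto simp: C_def single_def)

lemma C_expand: "f \<in> C i j l k \<Longrightarrow> f = (\<Sum>w\<in>words i j l k. smul (f w) (single w))"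
proof
  fix w assume f: "f \<in> C i j l k"
  have "(\<Sum>x\<in>words i j l k. f x * single x w) = (\<Sum>x\<in>words i j l k. if x = w then f x else 0)"
    by (rule sum.cong) (auto simp: single_def)
  then show "f w = (\<Sum>w\<in>words i j l k. smul (f w) (single w)) w"
    using f by (auto simp: fun_sum_apply smul_simps finite_words C_def)
qed

lemma C0_closed: "f \<in> C i j l 0 \<Longrightarrow> d f = 0"
  using C_d[of f i j l 0] C_trivial[of l "-1" "d f" i j] by simp

lemma C0_expand:
  assumes "f \<in> C i v l 0" "l \<noteq> 0"
  shows "f = (\<Sum>u\<in>nb v. lmul (Arr u v) (coef (Arr u v) f))"
proof (rule C_eqI[OF assms(1) _ assms(2)])
  show "(\<Sum>u\<in>nb v. lmul (Arr u v) (coef (Arr u v) f)) \<in> C i v l 0"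
    by (intro fvs.subspace_sum[OF C_subspace']) (auto simp: nb_def intro!: C_lmul_Arr C_coef(1)[OF assms(1)])
  show "coef (Lp v) f = coef (Lp v) (\<Sum>u\<in>nb v. lmul (Arr u v) (coef (Arr u v) f))"
    using C_trivial[OF _ C_coef(2)[OF assms(1)]] by (simp add: coef_sum)
  fix u assume "adj t u v"
  have "(\<Sum>x\<in>nb v. if Arr u v = Arr x v then coef (Arr x v) f else 0) = (\<Sum>x\<in>nb v. if x = u then coef (Arr x v) f else 0)"
    by (rule sum.cong) auto
  then show "coef (Arr u v) f = coef (Arr u v) (\<Sum>u\<in>nb v. lmul (Arr u v) (coef (Arr u v) f))"
    using \<open>adj t u v\<close> by (simp add: coef_sum nb_def[symmetric]) (simp add: nb_def)
qed

lemma B_lmul: "x \<in> B i v (l - 1) k \<Longrightarrow> adj t v u \<Longrightarrow> lmul (Arr v u) x \<in> B i u l k"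
proof -
  assume "x \<in> B i v (l - 1) k" and vu: "adj t v u"
  then obtain y where "y \<in> C i v (l - 1) (k + 1)" "x = d y" by (auto simp: B_def)
  then have "lmul (Arr v u) y \<in> C i u l (k + 1)" "lmul (Arr v u) x = d (lmul (Arr v u) y)"
    using C_lmul_Arr vu by auto
  then show "lmul (Arr v u) x \<in> B i u l k" unfolding B_def by blast
qed

lemma B_lmul': "x \<in> B i v l k \<Longrightarrow> adj t v u \<Longrightarrow> lmul (Arr v u) x \<in> B i u (l + 1) k"
  using B_lmul[of x i v "l + 1" k u] by simp

lemma C_lmul': "x \<in> C i v l k \<Longrightarrow> adj t v u \<Longrightarrow> lmul (Arr v u) x \<in> C i u (l + 1) k"
  using C_lmul_Arr[of x i v "l + 1" k u] by simp

lemma B_twist: "lmul (Arr v u) x \<in> B i u l k \<longleftrightarrow> twist v u x \<in> B i u l k" if "adj t v u"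
  unfolding twist_def using that B_subspace(4)[of _ i u l k "e v u"] smul_smul_e by metis

text \<open>Exactness in the middle of Pi_{l-2}(v) -> sum of the Pi_{l-1}(u) -> Pi_l(v), where the
  first map is theta_v and the second is given by the arrows.\<close>

lemma B0_coef:
  assumes "f \<in> B i v l 0"
  shows "\<exists>y \<in> C i v (l - 2) 0. \<forall>u. adj t u v \<longrightarrow> coef (Arr u v) f - twist v u y \<in> B i u (l - 1) 0"
proof -
  obtain g where g: "g \<in> C i v l 1" "f = d g" using assms by (auto simp: B_def)
  have "coef (Arr u v) f - twist v u (coef (Lp v) g) \<in> B i u (l - 1) 0" if "adj t u v" for u
    using C_coef(1)[OF g(1)] that by (auto simp: g(2) coef_d_at B_def)
  moreover have "coef (Lp v) g \<in> C i v (l - 2) 0" using C_coef(2)[OF g(1)] by simp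
  ultimately show ?thesis by blast
qed

definition lin :: "((letter list \<Rightarrow> 'k::field) \<Rightarrow> letter list \<Rightarrow> 'k) \<Rightarrow> bool" where
  "lin F \<longleftrightarrow> (\<forall>x y. F (x + y) = F x + F y) \<and> (\<forall>c x. F (smul c x) = smul c (F x))"

lemma lin_zero: "lin F \<Longrightarrow> F 0 = 0"
  unfolding lin_def by (metis fvs.scale_zero_left)

lemma lin_sum: "lin F \<Longrightarrow> F (sum f S) = (\<Sum>x\<in>S. F (f x))"
  by (induction S rule: infinite_finite_induct) (auto simp: lin_zero, auto simp: lin_def)

text \<open>Maps of representatives that descend to Pi_l(v); this avoids forming the
  quotient.\<close>

definition end_on :: "((letter list \<Rightarrow> 'k::field) \<Rightarrow> letter list \<Rightarrow> 'k) \<Rightarrow> nat \<Rightarrow> nat \<Rightarrow> int \<Rightarrow> bool" where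
  "end_on F i v l \<longleftrightarrow> lin F \<and> (\<forall>x\<in>C i v l 0. F x \<in> C i v l 0) \<and> (\<forall>x\<in>B i v l 0. F x \<in> B i v l 0)"

definition scalar_on :: "'k::field \<Rightarrow> ((letter list \<Rightarrow> 'k) \<Rightarrow> letter list \<Rightarrow> 'k) \<Rightarrow> nat \<Rightarrow> nat \<Rightarrow> int \<Rightarrow> bool" where
  "scalar_on c F i v l \<longleftrightarrow> (\<forall>x\<in>C i v l 0. F x - smul c x \<in> B i v l 0)"

definition compat :: "(nat \<Rightarrow> (letter list \<Rightarrow> 'k::field) \<Rightarrow> letter list \<Rightarrow> 'k) \<Rightarrow>
   (nat \<Rightarrow> (letter list \<Rightarrow> 'k) \<Rightarrow> letter list \<Rightarrow> 'k) \<Rightarrow> nat \<Rightarrow> int \<Rightarrow> bool" where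
  "compat F G i l \<longleftrightarrow> (\<forall>v u. adj t v u \<longrightarrow> (\<forall>x\<in>C i v l 0.
     G u (lmul (Arr v u) x) - lmul (Arr v u) (F v x) \<in> B i u (l + 1) 0))"

text \<open>Write \<open>\<Pi>\<^sub>l(v)\<close> for the quotient of \<^term>\<open>C i v l 0\<close> by \<^term>\<open>B i v l 0\<close>. The arrows make
  \<open>\<Pi>\<^sub>l\<close> and \<open>\<Pi>\<^bsub>l+1\<^esub>\<close> a representation of the bipartite double cover of the diagram, whose
  endomorphisms are represented by pairs \<open>F\<close>, \<open>G\<close>.\<close>
definition brick :: "'k::field itself \<Rightarrow> nat \<Rightarrow> int \<Rightarrow> bool" where
  "brick _ i l \<longleftrightarrow> (\<forall>F G. (\<forall>v. end_on (F v) i v l \<and> end_on (G v) i v (l + 1)) \<longrightarrow> compat F G i l \<longrightarrow>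
     (\<exists>c :: 'k. \<forall>v. scalar_on c (F v) i v l \<and> scalar_on c (G v) i v (l + 1)))"

definition theta_inj :: "'k::field itself \<Rightarrow> nat \<Rightarrow> int \<Rightarrow> bool" where
  "theta_inj _ i l \<longleftrightarrow> (\<forall>v. \<forall>x \<in> C i v l 0. 
     (\<forall>u. adj t v u \<longrightarrow> lmul (Arr v u) x \<in> B i u (l + 1) 0) \<longrightarrow> (x :: letter list \<Rightarrow> 'k) \<in> B i v l 0)"

definition simple_end :: "'k::field itself \<Rightarrow> nat \<Rightarrow> int \<Rightarrow> nat \<Rightarrow> bool" where
  "simple_end _ i l v0 \<longleftrightarrow> (\<exists>x0 :: letter list \<Rightarrow> 'k. x0 \<in> C i v0 l 0 \<and> x0 \<notin> B i v0 l 0 \<and>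
     (\<forall>x \<in> C i v0 l 0. \<exists>c. x - smul c x0 \<in> B i v0 l 0)) \<and>
   (\<forall>v. v \<noteq> v0 \<longrightarrow> (C i v l 0 :: (letter list \<Rightarrow> 'k) set) \<subseteq> B i v l 0) \<and>
   (\<forall>v. (C i v (l + 1) 0 :: (letter list \<Rightarrow> 'k) set) \<subseteq> B i v (l + 1) 0)"

text \<open>A nonzero vector killed by all arrows spans the image of an endomorphism.\<close>
lemma brick_dichotomy:
  assumes b: "brick TYPE('k::field) i l" and n: "\<not> theta_inj TYPE('k) i l"
  shows "\<exists>v0. simple_end TYPE('k) i l v0"
proof -
  obtain v0 and x0 :: "letter list \<Rightarrow> 'k" where x0: "x0 \<in> C i v0 l 0" "x0 \<notin> B i v0 l 0"
    and kill: "\<And>u. adj t v0 u \<Longrightarrow> lmul (Arr v0 u) x0 \<in> B i u (l + 1) 0"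
    using n unfolding theta_inj_def by blast
  obtain g :: "(letter list \<Rightarrow> 'k) \<Rightarrow> 'k" where g: "\<And>y z. g (y + z) = g y + g z" "\<And>c y. g (smul c y) = c * g y"
    "g x0 = 1" "\<And>y. y \<in> B i v0 l 0 \<Longrightarrow> g y = 0"
    using separating_functional[OF B_subspace' x0(2)] by blast
  let ?F = "\<lambda>v x. if v = v0 then smul (g x) x0 else 0"
  let ?G = "\<lambda>v x. 0 :: letter list \<Rightarrow> 'k"
  have "end_on (?F v) i v l" for v
    using x0(1) g by (auto simp: end_on_def lin_def fvs.scale_left_distrib intro: C_subspace)
  moreover have "end_on (?G v) i v (l + 1)" for v
    by (auto simp: end_on_def lin_def)
  moreover have "compat ?F ?G i l"
    using kill by (auto simp: compat_def intro!: B_subspace)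
  ultimately obtain c where "\<forall>v. scalar_on c (?F v) i v l \<and> scalar_on c (?G v) i v (l + 1)"
    using b unfolding brick_def by fastforce
  then have c: "\<And>v x. x \<in> C i v l 0 \<Longrightarrow> ?F v x - smul c x \<in> B i v l 0" 
    "\<And>v x. x \<in> C i v (l + 1) 0 \<Longrightarrow> - smul c x \<in> B i v (l + 1) 0"
    by (auto simp: scalar_on_def)
  have "smul (1 - c) x0 \<in> B i v0 l 0"
    using c(1)[OF x0(1)] g(3) by (simp add: fvs.scale_left_diff_distrib)
  \<comment> \<open>\<open>?F\<close> fixes x0, which is no boundary. Wherever \<open>?F\<close> or
    \<open>?G\<close> is zero, the scalar 1 then forces the quotient to vanish.\<close>
  have c1: "c = 1"
  proof (rule ccontr)
    assume "c \<noteq> 1"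
    then have "smul (inverse (1 - c)) (smul (1 - c) x0) = x0" by simp
    then show False using x0(2) B_subspace(4)[OF \<open>smul (1 - c) x0 \<in> B i v0 l 0\<close>] by metis
  qed
  have neg: "x \<in> B i v l k" if "- x \<in> B i v l k" for v l k and x :: "letter list \<Rightarrow> 'k"
    using B_subspace(3)[OF that] by simp
  have "C i v l 0 \<subseteq> (B i v l 0 :: (letter list \<Rightarrow> 'k) set)" if "v \<noteq> v0" for v
    using c(1)[of _ v] that c1 by (auto intro: neg)
  moreover have "C i v (l + 1) 0 \<subseteq> (B i v (l + 1) 0 :: (letter list \<Rightarrow> 'k) set)" for v
    using c(2)[of _ v] c1 by (auto intro: neg)
  moreover have "\<exists>c. x - smul c x0 \<in> B i v0 l 0" if "x \<in> C i v0 l 0" for x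
    using c(1)[OF that] c1 B_subspace(3)[of "smul (g x) x0 - x" i v0 l 0] by (auto intro: exI[of _ "g x"])
  ultimately show ?thesis using x0 unfolding simple_end_def by blast
qed

text \<open>A word of positive length without letters l has an arrow in front, so Pi_{l+1} is
  generated by the images of Pi_l and F determines G there.\<close>

lemma compat_sum:
  assumes "\<And>u. lin (G u)" "compat F G i l" "f \<in> C i v (l + 1) 0" "l \<ge> 0"
  shows "G v f - (\<Sum>u\<in>nb v. lmul (Arr u v) (F u (coef (Arr u v) f))) \<in> B i v (l + 1) 0"
proof -
  have "f = (\<Sum>u\<in>nb v. lmul (Arr u v) (coef (Arr u v) f))"
    using C0_expand[OF assms(3)] assms(4) by simp
  then have "G v f = (\<Sum>u\<in>nb v. G v (lmul (Arr u v) (coef (Arr u v) f)))"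
    using lin_sum[OF assms(1)] by metis
  then have "G v f - (\<Sum>u\<in>nb v. lmul (Arr u v) (F u (coef (Arr u v) f))) =
      (\<Sum>u\<in>nb v. G v (lmul (Arr u v) (coef (Arr u v) f)) - lmul (Arr u v) (F u (coef (Arr u v) f)))"
    by (simp add: sum_subtractf)
  also have "\<dots> \<in> B i v (l + 1) 0"
    using assms(2) C_coef(1)[OF assms(3)]
    by (intro fvs.subspace_sum[OF B_subspace']) (auto simp: compat_def nb_def)
  finally show ?thesis .
qed

text \<open>An endomorphism \<open>G\<close>, \<open>K\<close> of the reflected representation induces one on the kernels of the
  surjections \<open>\<Oplus>\<^sub>u \<Pi>\<^bsub>l+1\<^esub>(u) \<rightarrow> \<Pi>\<^bsub>l+2\<^esub>(v)\<close>, which are the \<open>\<Pi>\<^sub>l(v)\<close>.\<close>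
lemma compat_lift:
  fixes G K :: "nat \<Rightarrow> (letter list \<Rightarrow> 'k::field) \<Rightarrow> letter list \<Rightarrow> 'k"
  assumes G: "\<And>v. end_on (G v) i v (l + 1)" and K: "\<And>v. end_on (K v) i v (l + 2)"
    and GK: "compat G K i (l + 1)" and l: "l \<ge> 0" and inj: "theta_inj TYPE('k) i l"
  shows "\<exists>F. (\<forall>v. end_on (F v) i v l) \<and> compat F G i l"
proof -
  have "\<exists>y \<in> C i v l 0. \<forall>u. adj t v u \<longrightarrow> G u (twist v u x) - twist v u y \<in> B i u (l + 1) 0"
    if x: "x \<in> C i v l 0" for v x
  proof -
    \<comment> \<open>This is theta_v x, which is zero in Pi_{l+2}(v). Hence so is its image under
      K, which is represented by s, and exactness in the middle yields the vector y.\<close>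
    define f where "f = d (lmul (Lp v) x)"
    define s where "s = (\<Sum>u\<in>nb v. lmul (Arr u v) (G u (twist v u x)))"
    have "lmul (Lp v) x \<in> C i v (l + 2) 1" using x by (intro C_lmul_Lp) simp
    then have f: "f \<in> B i v (l + 2) 0" by (auto simp: f_def B_def)
    have fc: "coef (Arr u v) f = twist v u x" if "u \<in> nb v" for u
      using that by (simp add: f_def coef_d_at nb_def)
    have "K v f - (\<Sum>u\<in>nb v. lmul (Arr u v) (G u (coef (Arr u v) f))) \<in> B i v (l + 2) 0"
      using compat_sum[of K G i "l + 1" f v] K GK l B_sub_C[OF f] by (simp add: end_on_def add.commute add.left_commute)
    moreover have "(\<Sum>u\<in>nb v. lmul (Arr u v) (G u (coef (Arr u v) f))) = s"
      unfolding s_def by (rule sum.cong) (auto simp: fc)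
    moreover have "K v f \<in> B i v (l + 2) 0" using K f by (auto simp: end_on_def)
    ultimately have "K v f - (K v f - s) \<in> B i v (l + 2) 0" using B_subspace(2) by metis
    then have "s \<in> B i v (l + 2) 0" by simp
    then obtain y where y: "y \<in> C i v l 0" 
      "\<And>u. adj t u v \<Longrightarrow> coef (Arr u v) s - twist v u y \<in> B i u (l + 1) 0"
      using B0_coef[of s i v "l + 2"] by (auto simp: algebra_simps)
    have "coef (Arr u v) s = G u (twist v u x)" if "adj t u v" for u
    proof -
      have "coef (Arr u v) s = (\<Sum>x'\<in>nb v. if x' = u then G x' (twist v x' x) else 0)"
        unfolding s_def coef_sum by (rule sum.cong) auto
      then show ?thesis using that by (simp add: nb_def[symmetric]) (simp add: nb_def)
    qed
    then show ?thesis using y adj_sym by (metis (no_types, lifting))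
  qed
  then have ex: "\<exists>y. y \<in> C i v l 0 \<and> (\<forall>u. adj t v u \<longrightarrow> G u (twist v u x) - twist v u y \<in> B i u (l + 1) 0)"
    if "x \<in> C i v l 0" for v x using that by blast
  define Y where "Y v x = (SOME y. y \<in> C i v l 0 \<and>
    (\<forall>u. adj t v u \<longrightarrow> G u (twist v u x) - twist v u y \<in> B i u (l + 1) 0))" for v x
  have Y: "Y v x \<in> C i v l 0" "adj t v u \<Longrightarrow> G u (twist v u x) - twist v u (Y v x) \<in> B i u (l + 1) 0"
    if "x \<in> C i v l 0" for v x u
    using someI_ex[OF ex[OF that]] unfolding Y_def[symmetric] by blast+
  \<comment> \<open>The choices \<open>Y v x\<close> need not be linear in x, so only those for
    single words are kept and extended linearly.\<close>
  define F :: "nat \<Rightarrow> (letter list \<Rightarrow> 'k) \<Rightarrow> letter list \<Rightarrow> 'k" where "F v x = (\<Sum>w\<in>words i v l 0. smul (x w) (Y v (single w)))" for v x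
  have lG: "lin (G u)" for u using G by (simp add: end_on_def)
  have lF: "lin (F v)" for v
    by (auto simp: lin_def F_def fvs.scale_left_distrib sum.distrib fun_apply smul_simps fvs.scale_sum_right)
  have FC: "F v x \<in> C i v l 0" for v x
    unfolding F_def by (intro fvs.subspace_sum[OF C_subspace'] C_subspace Y C_single)
  have tF: "G u (twist v u x) - twist v u (F v x) \<in> B i u (l + 1) 0" if x: "x \<in> C i v l 0" and vu: "adj t v u" for x v u
  proof -
    have "twist v u x = (\<Sum>w\<in>words i v l 0. smul (x w) (twist v u (single w)))"
      by (subst C_expand[OF x]) (simp add: twist_def lmul_sum fvs.scale_sum_right mult.commute)
    then have "G u (twist v u x) = (\<Sum>w\<in>words i v l 0. smul (x w) (G u (twist v u (single w))))"
      using lG[of u] by (simp add: lin_sum) (simp add: lin_def)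
    moreover have "twist v u (F v x) = (\<Sum>w\<in>words i v l 0. smul (x w) (twist v u (Y v (single w))))"
      by (simp add: F_def twist_def lmul_sum fvs.scale_sum_right mult.commute)
    ultimately have "G u (twist v u x) - twist v u (F v x) =
      (\<Sum>w\<in>words i v l 0. smul (x w) (G u (twist v u (single w)) - twist v u (Y v (single w))))"
      by (simp add: sum_subtractf fvs.scale_right_diff_distrib)
    also have "\<dots> \<in> B i u (l + 1) 0"
      using vu by (intro fvs.subspace_sum[OF B_subspace'] B_subspace Y C_single)
    finally show ?thesis .
  qed
  have cF: "compat F G i l"
    unfolding compat_def
  proof (intro allI impI ballI)
    fix v u and x :: "letter list \<Rightarrow> 'k" assume vu: "adj t v u" and x: "x \<in> C i v l 0"
    have "smul (e v u) (G u (twist v u x) - twist v u (F v x)) = G u (lmul (Arr v u) x) - lmul (Arr v u) (F v x)"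
      using lG[of u] vu by (simp add: twist_def lin_def e_square fvs.scale_right_diff_distrib)
    then show "G u (lmul (Arr v u) x) - lmul (Arr v u) (F v x) \<in> B i u (l + 1) 0"
      using B_subspace(4)[OF tF[OF x vu]] by metis
  qed
  \<comment> \<open>Injectivity of theta enters here: it makes the induced map well defined on
    Pi_l(v).\<close>
  have "F v x \<in> B i v l 0" if x: "x \<in> B i v l 0" for v x
  proof -
    have "lmul (Arr v u) (F v x) \<in> B i u (l + 1) 0" if vu: "adj t v u" for u
    proof -
      have "G u (lmul (Arr v u) x) \<in> B i u (l + 1) 0"
        using G B_lmul'[OF x vu] by (auto simp: end_on_def)
      moreover have "G u (lmul (Arr v u) x) - lmul (Arr v u) (F v x) \<in> B i u (l + 1) 0"
        using cF vu B_sub_C[OF x] by (auto simp: compat_def)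
      ultimately have "G u (lmul (Arr v u) x) - (G u (lmul (Arr v u) x) - lmul (Arr v u) (F v x)) \<in> B i u (l + 1) 0"
        by (rule B_subspace(2))
      then show ?thesis by simp
    qed
    then show ?thesis using inj FC unfolding theta_inj_def by blast
  qed
  then show ?thesis using lF FC cF by (intro exI[of _ F]) (auto simp: end_on_def)
qed

text \<open>The pair G, K induces F by \<open>compat_lift\<close>; the brick property at l makes G a
  scalar, and K is the same scalar because arrows generate Pi_{l+2}.\<close>

lemma brick_step:
  assumes b: "brick TYPE('k::field) i l" and inj: "theta_inj TYPE('k) i l" and l: "l \<ge> 0"
  shows "brick TYPE('k) i (l + 1)"
  unfolding brick_def
proof (intro allI impI)
  fix G K :: "nat \<Rightarrow> (letter list \<Rightarrow> 'k) \<Rightarrow> letter list \<Rightarrow> 'k"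
  assume "\<forall>v. end_on (G v) i v (l + 1) \<and> end_on (K v) i v (l + 1 + 1)" and GK: "compat G K i (l + 1)"
  then have G: "\<And>v. end_on (G v) i v (l + 1)" and K: "\<And>v. end_on (K v) i v (l + 2)" by (auto simp: add.assoc)
  obtain F where "\<And>v. end_on (F v) i v l" "compat F G i l"
    using compat_lift[OF G K GK l inj] by blast
  then obtain c where c: "\<And>v. scalar_on c (G v) i v (l + 1)"
    using b G unfolding brick_def by metis
  have "K v f - smul c f \<in> B i v (l + 2) 0" if f: "f \<in> C i v (l + 2) 0" for v f
  proof -
    have 1: "K v f - (\<Sum>u\<in>nb v. lmul (Arr u v) (G u (coef (Arr u v) f))) \<in> B i v (l + 2) 0"
      using compat_sum[of K G i "l + 1" f v] K GK l f by (simp add: end_on_def add.commute add.left_commute)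
    have "smul c f = (\<Sum>u\<in>nb v. lmul (Arr u v) (smul c (coef (Arr u v) f)))"
      by (subst C0_expand[OF f]) (use l in \<open>auto simp: fvs.scale_sum_right\<close>)
    then have "(\<Sum>u\<in>nb v. lmul (Arr u v) (G u (coef (Arr u v) f))) - smul c f =
      (\<Sum>u\<in>nb v. lmul (Arr u v) (G u (coef (Arr u v) f) - smul c (coef (Arr u v) f)))"
      by (simp add: sum_subtractf)
    also have "\<dots> \<in> B i v (l + 2) 0"
    proof (intro fvs.subspace_sum[OF B_subspace'] B_lmul)
      fix u assume "u \<in> nb v" then show "adj t u v" by (simp add: nb_def)
      show "G u (coef (Arr u v) f) - smul c (coef (Arr u v) f) \<in> B i u (l + 2 - 1) 0"
        using c[of u] C_coef(1)[OF f, of u] by (simp add: scalar_on_def algebra_simps)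
    qed
    finally show ?thesis using B_subspace(1)[OF 1] by fastforce
  qed
  then show "\<exists>c. \<forall>v. scalar_on c (G v) i v (l + 1) \<and> scalar_on c (K v) i v (l + 1 + 1)"
    using c by (intro exI[of _ c]) (simp add: scalar_on_def add.assoc)
qed

text \<open>Acyclicity is carried at two consecutive lengths because the cone of length l + 2 is
  built from both.\<close>

definition good :: "'k::field itself \<Rightarrow> nat \<Rightarrow> int \<Rightarrow> bool" where
  "good _ i l \<longleftrightarrow> brick TYPE('k) i l \<and>
    (\<forall>v k. k \<ge> 1 \<longrightarrow> (Z i v l k :: (letter list \<Rightarrow> 'k) set) \<subseteq> B i v l k \<and>
       (Z i v (l + 1) k :: (letter list \<Rightarrow> 'k) set) \<subseteq> B i v (l + 1) k) \<and>
    (\<exists>v. \<not> (C i v l 0 :: (letter list \<Rightarrow> 'k) set) \<subseteq> B i v l 0)"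

text \<open>New cohomology with k at least 1 in the cone of length l + 2 could only sit at k = 1, as
  the kernel of theta_v on Pi_l(v). The same injectivity moves a nonzero class from Pi_l to
  Pi_{l+1}.\<close>

lemma good_step:
  assumes g: "good TYPE('k::field) i l" and inj: "theta_inj TYPE('k) i l" and l: "l \<ge> 0"
  shows "good TYPE('k) i (l + 1)"
proof -
  have ac: "Z i v l k \<subseteq> (B i v l k :: (letter list \<Rightarrow> 'k) set)" "Z i v (l + 1) k \<subseteq> (B i v (l + 1) k :: (letter list \<Rightarrow> 'k) set)" 
    if "k \<ge> 1" for v k using g that by (auto simp: good_def)
  have "f \<in> B i v (l + 2) k" if f: "f \<in> Z i v (l + 2) k" and k: "k \<ge> 1" for v k and f :: "letter list \<Rightarrow> 'k"
  proof (rule cone_boundary[OF f])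
    show "l + 2 \<noteq> 0" using l by simp
    show "(Z i u (l + 2 - 1) k :: (letter list \<Rightarrow> 'k) set) \<subseteq> B i u (l + 2 - 1) k" if "adj t u v" for u
      using ac(2)[OF k, of u] by (simp add: algebra_simps)
    have fL: "coef (Lp v) f \<in> Z i v l (k - 1)" using Z_coef(1)[OF f] by simp
    show "coef (Lp v) f \<in> B i v (l + 2 - 2) (k - 1)"
    proof (cases "k = 1")
      case False
      then show ?thesis using fL ac(1)[of "k - 1" v] k by auto
    next
      case True
      have "lmul (Arr v u) (coef (Lp v) f) \<in> B i u (l + 1) 0" if vu: "adj t v u" for u
      proof -
        have "twist v u (coef (Lp v) f) = d (- coef (Arr u v) f)"
          using Z_coef(2)[OF f, of u] vu adj_sym by simp
        moreover have "- coef (Arr u v) f \<in> C i u (l + 1) 1"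
          using C_subspace(3)[OF C_coef(1)[OF Z_sub_C[OF f], of u]] True by (simp add: algebra_simps)
        ultimately have "twist v u (coef (Lp v) f) \<in> B i u (l + 1) 0" by (metis B_def add_0 image_eqI)
        then show ?thesis unfolding B_twist[OF vu] .
      qed
      then show ?thesis using inj Z_sub_C[OF fL] True by (auto simp: theta_inj_def)
    qed
  qed
  moreover have "\<exists>v. \<not> (C i v (l + 1) 0 :: (letter list \<Rightarrow> 'k) set) \<subseteq> B i v (l + 1) 0"
  proof (rule ccontr)
    assume n: "\<not> ?thesis"
    obtain v and x :: "letter list \<Rightarrow> 'k" where x: "x \<in> C i v l 0" "x \<notin> B i v l 0" using g by (auto simp: good_def)
    then show False using inj n C_lmul'[OF x(1)] unfolding theta_inj_def by blast
  qed
  ultimately show ?thesis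
    using g ac(2) brick_step[OF _ inj l] by (auto simp: good_def add.assoc)
qed

text \<open>There are no nonzero boundaries in lengths 0 and 1. Pi_0 is spanned by the idempotent at
  i, whose image fixes the scalar, and Pi_1 is generated from it by arrows.\<close>

lemma good_0:
  assumes i: "i < rank t"
  shows "good TYPE('k::field) i 0"
proof -
  have triv: "B i v l k = ({0} :: (letter list \<Rightarrow> 'k) set)" if "l < 2 * (k + 1)" for v l k
  proof -
    have "C i v l (k + 1) = ({0} :: (letter list \<Rightarrow> 'k) set)" using that C_trivial[of l "k + 1" _ i v] C_zero by blast
    then show ?thesis by (simp add: B_def)
  qed
  have triv': "Z i v l k \<subseteq> (B i v l k :: (letter list \<Rightarrow> 'k) set)" if "l < 2 * k" for v l k
    
  proof
    fix x :: "letter list \<Rightarrow> 'k" assume "x \<in> Z i v l k"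
    then have "x = 0" using C_trivial[of l k x i v] that by (auto simp: Z_def)
    then show "x \<in> B i v l k" by simp
  qed
  have "[] \<in> words i i 0 0" using i by (simp add: words_Nil)
  then have one: "(single [] :: letter list \<Rightarrow> 'k) \<in> C i i 0 0" by (rule C_single)
  have C00: "x = smul (x []) (single [])" "v \<noteq> i \<Longrightarrow> x = 0" if x: "x \<in> C i v 0 0" for v and x :: "letter list \<Rightarrow> 'k"
  proof -
    have *: "x w = 0" if "w \<noteq> []" for w
    proof (rule ccontr)
      assume "x w \<noteq> 0"
      then have "w \<in> words i v 0 0" using x by (auto simp: C_def)
      then show False using that
      proof (cases w)
        case (Cons a w')
        then show False using \<open>w \<in> words i v 0 0\<close> words_empty by (cases a) (auto simp: words_Cons)
      qed simp
    qed
    then show "x = smul (x []) (single [])" by (auto simp: fun_eq_iff smul_simps single_def)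
    show "x = 0" if "v \<noteq> i"
    proof
      fix w show "x w = (0 :: letter list \<Rightarrow> 'k) w"
        using *[of w] C_Nil[OF x] that by (cases "w = []") (auto simp: fun_apply)
    qed
  qed
  have "single [] \<noteq> (0 :: letter list \<Rightarrow> 'k)" by (auto simp: single_def fun_eq_iff fun_apply)
  then have "\<not> (C i i 0 0 :: (letter list \<Rightarrow> 'k) set) \<subseteq> B i i 0 0" using one triv[of 0 0 i] by auto
  moreover have "brick TYPE('k) i 0"
    unfolding brick_def
  proof (intro allI impI)
    fix F G :: "nat \<Rightarrow> (letter list \<Rightarrow> 'k) \<Rightarrow> letter list \<Rightarrow> 'k"
    assume E: "\<forall>v. end_on (F v) i v 0 \<and> end_on (G v) i v (0 + 1)" and FG: "compat F G i 0"
    define c where "c = F i (single []) []"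
    have F1: "F i (single []) = smul c (single [])"
      unfolding c_def using E one by (intro C00(1)) (auto simp: end_on_def)
    have F: "F v x = smul c x" if x: "x \<in> C i v 0 0" for v x
    proof (cases "v = i")
      case True
      have "F i x = F i (smul (x []) (single []))" using C00(1)[OF x] by metis
      also have "\<dots> = smul (x []) (smul c (single []))" using E F1 by (auto simp: end_on_def lin_def)
      also have "\<dots> = smul c (smul (x []) (single []))" by (simp add: mult.commute)
      also have "\<dots> = smul c x" using C00(1)[OF x] by metis
      finally show ?thesis using True by simp
    next
      case False
      then show ?thesis using C00(2)[OF x] E lin_zero[of "F v"] by (auto simp: end_on_def)
    qed
    have "G v f = smul c f" if f: "f \<in> C i v 1 0" for v f
    proof -
      have "G v f = (\<Sum>u\<in>nb v. lmul (Arr u v) (F u (coef (Arr u v) f)))"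
        using compat_sum[OF _ FG, of f v] E f triv[of 1 0 v] by (auto simp: end_on_def)
      also have "\<dots> = (\<Sum>u\<in>nb v. lmul (Arr u v) (smul c (coef (Arr u v) f)))"
        using F C_coef(1)[OF f] by (intro sum.cong) auto
      also have "\<dots> = smul c (\<Sum>u\<in>nb v. lmul (Arr u v) (coef (Arr u v) f))"
        by (simp add: fvs.scale_sum_right)
      also have "\<dots> = smul c f" using C0_expand[OF f] by simp
      finally show ?thesis .
    qed
    then show "\<exists>c. \<forall>v. scalar_on c (F v) i v 0 \<and> scalar_on c (G v) i v (0 + 1)"
      using F by (auto simp: scalar_on_def intro!: exI[of _ c])
  qed
  ultimately show ?thesis using triv' by (auto simp: good_def)
qed

subsection \<open>Euler characteristics\<close>

lemma C_span: "(C i j l k :: (letter list \<Rightarrow> 'k::field) set) \<subseteq> fvs.span (single ` words i j l k)"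
proof
  fix f :: "letter list \<Rightarrow> 'k" assume f: "f \<in> C i j l k"
  show "f \<in> fvs.span (single ` words i j l k)"
    by (subst C_expand[OF f]) (intro fvs.span_sum fvs.span_scale fvs.span_base imageI)
qed

lemma finite_singles: "finite (single ` words i j l k)"
  using finite_words by blast

lemma dim_C: "fvs.dim (C i j l k :: (letter list \<Rightarrow> 'k::field) set) = card (words i j l k)"
proof (rule fvs.dim_unique[OF _ C_span])
  have inj: "inj_on (single :: _ \<Rightarrow> letter list \<Rightarrow> 'k) (words i j l k)"
    by (rule inj_onI) (metis single_def zero_neq_one)
  then show "card (single ` words i j l k :: (letter list \<Rightarrow> 'k) set) = card (words i j l k)"
    by (rule card_image)
  show "single ` words i j l k \<subseteq> (C i j l k :: (letter list \<Rightarrow> 'k) set)" using C_single by blast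
  show "fvs.independent (single ` words i j l k :: (letter list \<Rightarrow> 'k) set)"
  proof (rule fvs.independent_if_scalars_zero[OF finite_singles])
    fix c :: "(letter list \<Rightarrow> 'k) \<Rightarrow> 'k" and x :: "letter list \<Rightarrow> 'k"
    assume z: "(\<Sum>x\<in>single ` words i j l k. smul (c x) x) = 0" and "x \<in> single ` words i j l k"
    then obtain w where w: "w \<in> words i j l k" "x = single w" by blast
    have "(\<Sum>x\<in>single ` words i j l k. smul (c x) x) w = (\<Sum>v\<in>words i j l k. c (single v) * single v w)"
      by (simp add: sum.reindex[OF inj] fun_sum_apply smul_simps)
    also have "\<dots> = (\<Sum>v\<in>words i j l k. if v = w then c (single v) else 0)"
      by (rule sum.cong) (auto simp: single_def)
    also have "\<dots> = c x" using w finite_words by simp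
    finally show "c x = 0" using z by (simp add: fun_apply)
  qed
qed

lemma d_vs_linear: "Vector_Spaces.linear smul smul (d :: (letter list \<Rightarrow> 'k::field) \<Rightarrow> _)"
  by unfold_locales auto

lemma dim_Z_B:
  "card (words i j l k) = fvs.dim (Z i j l k :: (letter list \<Rightarrow> 'k::field) set) + fvs.dim (B i j l (k - 1) :: (letter list \<Rightarrow> 'k) set)"
proof -
  have "fvs.dim (C i j l k :: (letter list \<Rightarrow> 'k) set) =
      fvs.dim {x \<in> C i j l k. d (x :: letter list \<Rightarrow> 'k) = 0} + fvs.dim (d ` (C i j l k :: (letter list \<Rightarrow> 'k) set))"
    by (rule rank_nullity[OF d_vs_linear C_subspace' C_span finite_singles])
  then show ?thesis by (simp add: dim_C Z_def B_def)
qed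

text \<open>A word with k letters l has length at least 2k, so stopping at \<open>nat l\<close>
  loses nothing.\<close>

definition chi :: "nat \<Rightarrow> nat \<Rightarrow> int \<Rightarrow> int" where
  "chi i j l = (\<Sum>k\<le>nat l. (- 1) ^ k * int (card (words i j l (int k))))"

lemma chi_bound: "nat l \<le> m \<Longrightarrow> chi i j l = (\<Sum>k\<le>m. (- 1) ^ k * int (card (words i j l (int k))))"
  unfolding chi_def
proof (rule sum.mono_neutral_left)
  have "words i j l (int k) = {}" if "k > nat l" for k
    using that by (intro words_empty) linarith
  then show "\<forall>k\<in>{..m} - {..nat l}. (- 1) ^ k * int (card (words i j l (int k))) = 0" by simp
qed auto

lemma words_split:
  assumes "l \<noteq> 0"
  shows "words i j l k = (\<Union>u\<in>nb j. (#) (Arr u j) ` words i u (l - 1) k) \<union> (#) (Lp j) ` words i j (l - 2) (k - 1)"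
proof (intro subset_antisym subsetI)
  fix w assume w: "w \<in> words i j l k"
  show "w \<in> (\<Union>u\<in>nb j. (#) (Arr u j) ` words i u (l - 1) k) \<union> (#) (Lp j) ` words i j (l - 2) (k - 1)"
  proof (cases w)
    case Nil
    then show ?thesis using w assms by (simp add: words_Nil)
  next
    case (Cons a w')
    then show ?thesis using w by (cases a) (auto simp: words_Cons nb_def)
  qed
qed (auto simp: words_Cons nb_def)

lemma card_words:
  assumes "l \<noteq> 0"
  shows "card (words i j l k) = (\<Sum>u\<in>nb j. card (words i u (l - 1) k)) + card (words i j (l - 2) (k - 1))"
proof -
  have "card (words i j l k) = card (\<Union>u\<in>nb j. (#) (Arr u j) ` words i u (l - 1) k)
      + card ((#) (Lp j) ` words i j (l - 2) (k - 1))"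
    unfolding words_split[OF assms, of i j k]
    by (rule card_Un_disjoint) (auto simp: finite_words)
  also have "card (\<Union>u\<in>nb j. (#) (Arr u j) ` words i u (l - 1) k) = (\<Sum>u\<in>nb j. card ((#) (Arr u j) ` words i u (l - 1) k))"
    by (rule card_UN_disjoint) (auto simp: finite_words)
  finally show ?thesis by (simp add: card_image)
qed

lemma chi_neg: "l < 0 \<Longrightarrow> chi i j l = 0"
  by (simp add: chi_def words_empty)

lemma words_00: "words i j 0 0 = (if i = j \<and> j < rank t then {[]} else {})"
proof -
  have "w = []" if "w \<in> words i j 0 0" for w
  proof (cases w)
    case (Cons a w')
    then show ?thesis using that by (cases a) (auto simp: words_Cons words_empty)
  qed
  then show ?thesis using words_Nil[of i j 0 0] by auto
qed

lemma chi_0: "chi i j 0 = (if i = j \<and> j < rank t then 1 else 0)"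
  by (simp add: chi_def words_00)

text \<open>The first letter is an arrow or l_j; removing l_j lowers k by one, hence the minus
  sign.\<close>

lemma chi_rec:
  assumes "l > 0"
  shows "chi i j l = (\<Sum>u\<in>nb j. chi i u (l - 1)) - chi i j (l - 2)"
proof -
  define m where "m = nat (l - 1)"
  have m: "nat l = Suc m" using assms by (simp add: m_def)
  have "chi i j l = (\<Sum>k\<le>Suc m. (- 1) ^ k * (\<Sum>u\<in>nb j. int (card (words i u (l - 1) (int k)))))
      + (\<Sum>k\<le>Suc m. (- 1) ^ k * int (card (words i j (l - 2) (int k - 1))))"
    unfolding chi_def m using assms by (simp add: card_words algebra_simps sum.distrib)
  also have "(\<Sum>k\<le>Suc m. (- 1) ^ k * (\<Sum>u\<in>nb j. int (card (words i u (l - 1) (int k))))) = (\<Sum>u\<in>nb j. chi i u (l - 1))"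
    unfolding sum_distrib_left
    by (subst sum.swap, rule sum.cong) (auto simp: chi_bound[of "l - 1" "Suc m"] m_def)
  also have "(\<Sum>k\<le>Suc m. (- 1) ^ k * int (card (words i j (l - 2) (int k - 1)))) = - chi i j (l - 2)"
  proof -
    have "(\<Sum>k\<le>Suc m. (- 1) ^ k * int (card (words i j (l - 2) (int k - 1)))) = 
      (\<Sum>k\<le>m. (- 1) ^ Suc k * int (card (words i j (l - 2) (int k))))"
      by (subst sum.atMost_Suc_shift) (simp add: words_empty)
    then show ?thesis using chi_bound[of "l - 2" m i j] by (simp add: sum_negf m_def)
  qed
  finally show ?thesis by simp
qed

text \<open>Where cocycles are boundaries, rank and nullity make the alternating sum telescope; the
  term left over at the top is zero for reasons of length.\<close>

lemma chi_eq_dim: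
  assumes ac: "\<And>k. k \<ge> 1 \<Longrightarrow> (Z i j l k :: (letter list \<Rightarrow> 'k::field) set) \<subseteq> B i j l k"
  shows "chi i j l = int (fvs.dim (C i j l 0 :: (letter list \<Rightarrow> 'k) set)) - int (fvs.dim (B i j l 0 :: (letter list \<Rightarrow> 'k) set))"
proof -
  let ?b = "\<lambda>k. int (fvs.dim (B i j l k :: (letter list \<Rightarrow> 'k) set))"
  have "(\<Sum>k\<le>m. (- 1) ^ k * int (card (words i j l (int k)))) =
    int (card (words i j l 0)) - ?b 0 + (- 1) ^ m * ?b (int m)" for m
  proof (induction m)
    case (Suc m)
    have "Z i j l (int (Suc m)) = (B i j l (int (Suc m)) :: (letter list \<Rightarrow> 'k) set)"
      using ac[of "int (Suc m)"] B_sub_Z by auto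
    then have "int (card (words i j l (int (Suc m)))) = ?b (int (Suc m)) + ?b (int m)"
      using dim_Z_B[of i j l "int (Suc m)", where 'k = 'k] by simp
    then show ?case using Suc.IH by (simp add: algebra_simps)
  qed simp
  moreover have "B i j l (int (nat l)) = ({0} :: (letter list \<Rightarrow> 'k) set)"
  proof -
    have "x = 0" if "x \<in> C i j l (int (nat l) + 1)" for x :: "letter list \<Rightarrow> 'k"
      using C_trivial[OF _ that] by fastforce
    then have "C i j l (int (nat l) + 1) = ({0} :: (letter list \<Rightarrow> 'k) set)" using C_zero by blast
    then show ?thesis by (simp add: B_def)
  qed
  moreover have "fvs.dim ({0} :: (letter list \<Rightarrow> 'k) set) = 0"
    by (rule fvs.dim_unique[of "{}"]) (auto simp: fvs.span_empty fvs.independent_empty)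
  ultimately show ?thesis unfolding chi_def by (simp add: dim_C)
qed

lemma C_B_dim:
  "fvs.dim (B i j l k :: (letter list \<Rightarrow> 'k::field) set) \<le> fvs.dim (C i j l k :: (letter list \<Rightarrow> 'k) set)"
  "fvs.dim (B i j l k :: (letter list \<Rightarrow> 'k::field) set) = fvs.dim (C i j l k :: (letter list \<Rightarrow> 'k) set)
     \<Longrightarrow> (C i j l k :: (letter list \<Rightarrow> 'k) set) \<subseteq> B i j l k"
  by (rule dim_subspace_le[OF _ B_subspace' C_subspace' C_span finite_singles]; auto intro: B_sub_C)+

lemma chi_nonneg:
  assumes "\<And>k. k \<ge> 1 \<Longrightarrow> (Z i j l k :: (letter list \<Rightarrow> 'k::field) set) \<subseteq> B i j l k"
  shows "chi i j l \<ge> 0" and "chi i j l = 0 \<longleftrightarrow> (C i j l 0 :: (letter list \<Rightarrow> 'k) set) \<subseteq> B i j l 0"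
proof -
  show "chi i j l \<ge> 0" using chi_eq_dim[OF assms] C_B_dim(1)[where 'k = 'k] by simp
  show "chi i j l = 0 \<longleftrightarrow> (C i j l 0 :: (letter list \<Rightarrow> 'k) set) \<subseteq> B i j l 0"
  proof
    assume "chi i j l = 0"
    then show "(C i j l 0 :: (letter list \<Rightarrow> 'k) set) \<subseteq> B i j l 0"
      using chi_eq_dim[OF assms] C_B_dim(2)[where 'k = 'k] by simp
  next
    assume "(C i j l 0 :: (letter list \<Rightarrow> 'k) set) \<subseteq> B i j l 0"
    then have "C i j l 0 = (B i j l 0 :: (letter list \<Rightarrow> 'k) set)" using B_sub_C by blast
    then show "chi i j l = 0" using chi_eq_dim[OF assms] by simp
  qed
qed

lemma good_chi:
  assumes g: "good TYPE('k::field) i l"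
  shows "chi i j l \<ge> 0" "chi i j (l + 1) \<ge> 0" "\<exists>j. chi i j l \<noteq> 0"
proof -
  have ac: "\<And>k v. k \<ge> 1 \<Longrightarrow> (Z i v l k :: (letter list \<Rightarrow> 'k::field) set) \<subseteq> B i v l k"
    "\<And>k v. k \<ge> 1 \<Longrightarrow> (Z i v (l + 1) k :: (letter list \<Rightarrow> 'k::field) set) \<subseteq> B i v (l + 1) k"
    using g by (auto simp: good_def)
  show "chi i j l \<ge> 0" by (rule chi_nonneg(1)[OF ac(1)])
  show "chi i j (l + 1) \<ge> 0" by (rule chi_nonneg(1)[OF ac(2)])
  show "\<exists>j. chi i j l \<noteq> 0" using g chi_nonneg(2)[OF ac(1)] by (auto simp: good_def)
qed

lemma simple_end_chi:
  assumes g: "good TYPE('k::field) i l" and s: "simple_end TYPE('k) i l v0"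
  shows "chi i j (l + 1) = 0" "chi i j l = (if j = v0 then 1 else 0)"
proof -
  have ac: "\<And>k v. k \<ge> 1 \<Longrightarrow> (Z i v l k :: (letter list \<Rightarrow> 'k::field) set) \<subseteq> B i v l k"
    "\<And>k v. k \<ge> 1 \<Longrightarrow> (Z i v (l + 1) k :: (letter list \<Rightarrow> 'k::field) set) \<subseteq> B i v (l + 1) k"
    using g by (auto simp: good_def)
  show "chi i j (l + 1) = 0" using chi_nonneg(2)[OF ac(2)] s by (auto simp: simple_end_def)
  show "chi i j l = (if j = v0 then 1 else 0)"
  proof (cases "j = v0")
    case False
    then show ?thesis using chi_nonneg(2)[OF ac(1)] s by (auto simp: simple_end_def)
  next
    case True
    obtain x0 :: "letter list \<Rightarrow> 'k" where "x0 \<in> C i v0 l 0" "x0 \<notin> B i v0 l 0"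
      "\<forall>x \<in> C i v0 l 0. \<exists>c. x - smul c x0 \<in> B i v0 l 0"
      using s by (auto simp: simple_end_def)
    then have "fvs.dim (C i v0 l 0 :: (letter list \<Rightarrow> 'k) set) = Suc (fvs.dim (B i v0 l 0 :: (letter list \<Rightarrow> 'k) set))"
      by (intro dim_subspace_Suc[where x = x0, OF _ B_subspace' C_subspace' C_span finite_singles])
        (auto intro: B_sub_C)
    then show ?thesis using chi_eq_dim[OF ac(1)] True by simp
  qed
qed

text \<open>By the recursion the matrices of Euler characteristics are polynomials in the adjacency
  matrix and so commute with it.\<close>

lemma chi_adj_comm: "(\<Sum>u\<in>nb i. chi u j (int l)) = (\<Sum>u\<in>nb j. chi i u (int l))"
proof (induction l arbitrary: j rule: less_induct)
  case (less l)
  have nb0: "i \<in> nb j \<longleftrightarrow> j \<in> nb i" for i j using adj_sym by (auto simp: nb_def)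
  show ?case
  proof (cases "l = 0")
    case True
    have "(\<Sum>u\<in>nb i. if u = j \<and> j < rank t then 1 else 0) = (\<Sum>u\<in>nb i. if u = j then 1 else 0 :: int)"
      "(\<Sum>u\<in>nb j. if i = u \<and> u < rank t then 1 else 0) = (\<Sum>u\<in>nb j. if u = i then 1 else 0 :: int)"
      by (rule sum.cong; auto simp: nb_def dest: adj_rank)+
    then show ?thesis using True nb0 by (simp add: chi_0)
  next
    case False
    have IH2: "(\<Sum>u\<in>nb i. chi u j (int l - 2)) = (\<Sum>u\<in>nb j. chi i u (int l - 2))" for j
    proof (cases "l = 1")
      case False
      then have eq: "int l - 2 = int (l - 2)" using \<open>l \<noteq> 0\<close> by simp
      show ?thesis unfolding eq by (rule less.IH) (use \<open>l \<noteq> 0\<close> in simp)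
    qed (simp add: chi_neg)
    have l1: "int l - 1 = int (l - 1)" using False by simp
    have IH1: "(\<Sum>u\<in>nb i. chi u j (int l - 1)) = (\<Sum>u\<in>nb j. chi i u (int l - 1))" for j
      unfolding l1 by (rule less.IH) (use False in simp)
    have "(\<Sum>u\<in>nb i. chi u j (int l)) = (\<Sum>u\<in>nb i. \<Sum>w\<in>nb j. chi u w (int l - 1)) - (\<Sum>u\<in>nb i. chi u j (int l - 2))"
      using False by (simp add: chi_rec sum_subtractf)
    also have "(\<Sum>u\<in>nb i. \<Sum>w\<in>nb j. chi u w (int l - 1)) = (\<Sum>w\<in>nb j. \<Sum>x\<in>nb w. chi i x (int l - 1))"
      by (subst sum.swap) (simp add: IH1)
    finally show ?thesis using False by (simp add: IH2 chi_rec sum_subtractf)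
  qed
qed

text \<open>The recursion acts on the second index only; \<open>chi_adj_comm\<close> moves the sum
  over neighbours to the first one.\<close>

lemma chi_sym: "chi i j (int l) = chi j i (int l)"
proof (induction l arbitrary: i j rule: less_induct)
  case (less l)
  show ?case
  proof (cases "l = 0")
    case True
    then show ?thesis by (auto simp: chi_0)
  next
    case False
    have IH2: "chi i j (int l - 2) = chi j i (int l - 2)" 
    proof (cases "l = 1")
      case False
      then have eq: "int l - 2 = int (l - 2)" using \<open>l \<noteq> 0\<close> by simp
      show ?thesis unfolding eq by (rule less.IH) (use \<open>l \<noteq> 0\<close> in simp)
    qed (simp add: chi_neg)
    have l1: "int l - 1 = int (l - 1)" using False by simp
    have "(\<Sum>u\<in>nb j. chi i u (int l - 1)) = (\<Sum>u\<in>nb i. chi u j (int l - 1))"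
      unfolding l1 by (rule chi_adj_comm[symmetric])
    also have "\<dots> = (\<Sum>u\<in>nb i. chi j u (int l - 1))"
      unfolding l1 using less.IH[of "l - 1"] False by (intro sum.cong) auto
    finally show ?thesis using False IH2 by (simp add: chi_rec)
  qed
qed

subsection \<open>The first zero row\<close>

lemma chi_rank: "\<not> (i < rank t \<and> j < rank t) \<Longrightarrow> chi i j l = 0"
proof -
  assume "\<not> (i < rank t \<and> j < rank t)"
  then have "words i j l k = {}" for k using words_rank by blast
  then show "chi i j l = 0" by (simp add: chi_def)
qed

lemma rank_pos: "0 < rank t"
  using valid by (cases t) auto

text \<open>Vertex 0 is an end of the diagram. In types A and D its rows have entries 0 and 1 up to
  the first zero row and can be written down.\<close>

definition row :: "nat \<Rightarrow> nat \<Rightarrow> int" where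
  "row l j = chi 0 j (int l)"

lemma row_rank: "\<not> j < rank t \<Longrightarrow> row l j = 0"
  by (simp add: row_def chi_rank)

lemma sum_nb_delta: "(\<Sum>u\<in>nb j. if u = a then 1 else 0 :: int) = (if adj t a j then 1 else 0)"
  by (simp add: nb_def[symmetric]) (simp add: nb_def)

lemma row_0: "row 0 j = (if j = 0 then 1 else 0)"
  using rank_pos by (auto simp: row_def chi_0)

lemma row_1: "row (Suc 0) j = (if adj t 0 j then 1 else 0)"
proof -
  have "row (Suc 0) j = (\<Sum>u\<in>nb j. row 0 u)" by (simp add: row_def chi_rec chi_neg)
  then show ?thesis unfolding row_0 sum_nb_delta .
qed

lemma row_rec: "row (Suc (Suc l)) j = (\<Sum>u\<in>nb j. row (Suc l) u) - row l j"
  using chi_rec[of "int (Suc (Suc l))" 0 j] by (simp add: row_def algebra_simps)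

lemma row_rec_delta:
  assumes "\<And>j. row (Suc l) j = (if j = a then 1 else 0)"
  shows "row (Suc (Suc l)) j = (if adj t a j then 1 else 0) - row l j"
  unfolding row_rec assms sum_nb_delta ..

text \<open>The single 1 walks from one end of the chain to the other and drops off at step n = h -
  1.\<close>

lemma row_A:
  assumes t: "t = TypeA n" and "l \<le> n"
  shows "row l j = (if j = l \<and> l < n then 1 else 0)"
  using assms(2)
proof (induction l arbitrary: j rule: less_induct)
  case (less l)
  have n: "n \<ge> 1" using valid t by simp
  consider "l = 0" | "l = Suc 0" | m where "l = Suc (Suc m)"
    by (cases l rule: nat.exhaust; metis not0_implies_Suc)
  then show ?case
  proof cases
    case 3
    have "row (Suc m) j = (if j = Suc m then 1 else 0)" for j
      using less.IH[of "Suc m" j] less.prems 3 by simp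
    moreover have "row m j = (if j = m then 1 else 0)" using less.IH[of m j] less.prems 3 by simp
    ultimately have "row l j = (if adj t (Suc m) j then 1 else 0) - (if j = m then 1 else 0)"
      unfolding 3 by (simp only: row_rec_delta)
    then show ?thesis using less.prems 3 by (auto simp: t adj_def)
  qed (use n row_0[of j] row_1[of j] in \<open>auto simp: t adj_def\<close>)
qed

text \<open>The 1 walks to the branch vertex n - 3, splits over the two short arms, reunites at the
  branch vertex, walks back to 0 and vanishes at step 2n - 3 = h - 1.\<close>

lemma row_D:
  assumes t: "t = TypeD n"
  shows "l \<le> n - 3 \<Longrightarrow> row l j = (if j = l then 1 else 0)"
    and "row (n - 2) j = (if j = n - 2 \<or> j = n - 1 then 1 else 0)"
    and "m \<le> n - 3 \<Longrightarrow> row (n - 1 + m) j = (if j = n - 3 - m then 1 else 0)"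
    and "row (2 * n - 3) j = 0"
proof -
  have n: "n \<ge> 4" using valid t by simp
  have 1: "row l j = (if j = l then 1 else 0)" if "l \<le> n - 3" for l j
    using that
  proof (induction l arbitrary: j rule: less_induct)
    case (less l)
    consider "l = 0" | "l = Suc 0" | m where "l = Suc (Suc m)"
      by (cases l rule: nat.exhaust; metis not0_implies_Suc)
    then show ?case
    proof cases
      case 3
      have "row (Suc m) j = (if j = Suc m then 1 else 0)" for j
        using less.IH[of "Suc m" j] less.prems 3 by simp
      moreover have "row m j = (if j = m then 1 else 0)" using less.IH[of m j] less.prems 3 by simp
      ultimately have "row l j = (if adj t (Suc m) j then 1 else 0) - (if j = m then 1 else 0)"
        unfolding 3 by (simp only: row_rec_delta)
      then show ?thesis using less.prems 3 n by (auto simp: t adj_def)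
    qed (use n less.prems row_0[of j] row_1[of j] in \<open>auto simp: t adj_def\<close>)
  qed
  then show "l \<le> n - 3 \<Longrightarrow> row l j = (if j = l then 1 else 0)" by blast
  \<comment> \<open>With n = p + 4 the truncated subtractions disappear.\<close>
  obtain p where p: "n = p + 4" using n by (metis add.commute le_Suc_ex)
  have 2: "row (p + 2) j = (if j = p + 2 \<or> j = p + 3 then 1 else 0)" for j
  proof -
    have "row (Suc p) j = (if j = Suc p then 1 else 0)" for j using 1[of "Suc p" j] p by simp
    from row_rec_delta[OF this] have "row (p + 2) j = (if adj t (Suc p) j then 1 else 0) - row p j" by simp
    then show ?thesis using 1[of p j] by (auto simp: t p adj_def)
  qed
  then show "row (n - 2) j = (if j = n - 2 \<or> j = n - 1 then 1 else 0)" using p by simp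
  have 3: "row (p + 3) j = (if j = p + 1 then 1 else 0)" for j
  proof -
    have "row (p + 3) j = (\<Sum>u\<in>nb j. row (p + 2) u) - row (p + 1) j"
      using row_rec[of "p + 1" j] by (simp add: numeral_eq_Suc)
    also have "(\<Sum>u\<in>nb j. row (p + 2) u) = (\<Sum>u\<in>nb j. (if u = p + 2 then 1 else 0) + (if u = p + 3 then 1 else 0))"
      unfolding 2 by (rule sum.cong) auto
    also have "\<dots> = (if adj t (p + 2) j then 1 else 0) + (if adj t (p + 3) j then 1 else 0)"
      by (simp only: sum.distrib sum_nb_delta)
    finally show ?thesis using 1[of "p + 1" j] by (auto simp: t p adj_def)
  qed
  have 4: "row (p + 3 + m) j = (if j = p + 1 - m then 1 else 0)" if "m \<le> p + 1" for m j
    using that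
  proof (induction m arbitrary: j rule: less_induct)
    case (less m)
    consider "m = 0" | "m = Suc 0" | q where "m = Suc (Suc q)"
      by (cases m rule: nat.exhaust; metis not0_implies_Suc)
    then show ?case
    proof cases
      case 1
      then show ?thesis using 3[of j] by simp
    next
      case 2
      have "row (Suc (p + 2)) j = (if j = p + 1 then 1 else 0)" for j using 3[of j] by (simp add: numeral_eq_Suc)
      from row_rec_delta[OF this] have "row (p + 3 + m) j = (if adj t (p + 1) j then 1 else 0) - row (p + 2) j"
        unfolding 2 by (simp add: numeral_eq_Suc)
      then show ?thesis using \<open>row (p + 2) j = _\<close> 2 by (auto simp: t p adj_def)
    next
      case q: 3
      obtain r where r: "p = q + Suc r" using less.prems q by (metis Suc_le_mono add.commute add_2_eq_Suc' add_Suc_right le_Suc_ex plus_1_eq_Suc)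
      have "row (Suc (p + 3 + q)) j = (if j = Suc r then 1 else 0)" for j
        using less.IH[of "Suc q" j] q r by simp
      from row_rec_delta[OF this] have "row (p + 3 + m) j = (if adj t (Suc r) j then 1 else 0) - row (p + 3 + q) j"
        unfolding q by simp
      moreover have "row (p + 3 + q) j = (if j = Suc (Suc r) then 1 else 0)"
        using less.IH[of q j] q r by simp
      moreover have "adj t (Suc r) j \<longleftrightarrow> j = Suc (Suc r) \<or> j = r"
        using r by (auto simp: t p adj_def)
      moreover have "p + 1 - m = r" using q r by simp
      ultimately show ?thesis by auto
    qed
  qed
  have "n - 1 + m = p + 3 + m" "n - 3 - m = p + 1 - m" "n - 3 = p + 1" using p by simp_all
  then show "m \<le> n - 3 \<Longrightarrow> row (n - 1 + m) j = (if j = n - 3 - m then 1 else 0)" using 4[of m j] by (simp only:)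
  have "row (Suc (p + 3 + p)) j = (if j = 0 then 1 else 0)" for j using 4[of "p + 1" j] by simp
  from row_rec_delta[OF this] have "row (p + 5 + p) j = (if adj t 0 j then 1 else 0) - row (p + 3 + p) j"
    by (simp add: numeral_eq_Suc)
  then have "row (p + 5 + p) j = 0" using 4[of p j] by (auto simp: t p adj_def)
  moreover have "2 * n - 3 = p + 5 + p" using p by simp
  ultimately show "row (2 * n - 3) j = 0" by simp
qed

lemma first_zero_row_sound:
  assumes nbs: "length nbs = n" "\<And>j. j < n \<Longrightarrow> distinct (nbs ! j) \<and> set (nbs ! j) = nb j" and n: "rank t = n"
    and "first_zero_row nbs m (map (row l) [0..<n]) (map (row (Suc l)) [0..<n])"
  shows "(\<forall>k. l \<le> k \<and> k \<le> l + m \<longrightarrow> (\<exists>j. row k j \<noteq> 0)) \<and> (\<forall>j. row (Suc (l + m)) j = 0)"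
  using assms(4)
proof (induction m arbitrary: l)
  case 0
  then show ?case using row_rank[of _ "Suc l"] n
    by (auto simp: list_ex_iff list_all_iff)
next
  case (Suc m)
  have "row_step nbs (map (row (Suc l)) [0..<n]) (map (row l) [0..<n]) = map (row (Suc (Suc l))) [0..<n]"
  proof (rule nth_equalityI)
    fix j assume "j < length (row_step nbs (map (row (Suc l)) [0..<n]) (map (row l) [0..<n]))"
    then have j: "j < n" using nbs(1) by simp
    have "(\<Sum>u\<leftarrow>nbs ! j. map (row (Suc l)) [0..<n] ! u) = (\<Sum>u\<in>nb j. map (row (Suc l)) [0..<n] ! u)"
      using nbs(2)[OF j] by (metis sum_list_distinct_conv_sum_set)
    also have "\<dots> = (\<Sum>u\<in>nb j. row (Suc l) u)"
      using adj_rank n by (intro sum.cong) (auto simp: nb_def)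
    finally show "row_step nbs (map (row (Suc l)) [0..<n]) (map (row l) [0..<n]) ! j = map (row (Suc (Suc l))) [0..<n] ! j"
      using j nbs(1) by (simp add: row_rec)
  qed (use nbs(1) in simp)
  then have z: "first_zero_row nbs m (map (row (Suc l)) [0..<n]) (map (row (Suc (Suc l))) [0..<n])"
    and ex: "\<exists>j. row l j \<noteq> 0"
    using Suc.prems by (auto simp: list_ex_iff simp del: row_step.simps)
  show ?case
  proof (intro conjI allI impI)
    fix k assume "l \<le> k \<and> k \<le> l + Suc m"
    then show "\<exists>j. row k j \<noteq> 0" using ex Suc.IH[OF z] by (cases "k = l") auto
  next
    fix j show "row (Suc (l + Suc m)) j = 0" using Suc.IH[OF z] by simp
  qed
qed

lemma row_E:
  assumes t: "t = TypeE n"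
  shows "(\<forall>l<coxeter_number t - 1. \<exists>j. row l j \<noteq> 0) \<and> (\<forall>j. row (coxeter_number t - 1) j = 0)"
proof -
  \<comment> \<open>The neighbour lists are supplied by hand. Quantifying over
    \<open>set [0..<n]\<close> makes their correctness decidable by evaluation.\<close>
  have main: "(\<forall>k\<le>m. \<exists>j. row k j \<noteq> 0) \<and> (\<forall>j. row (Suc m) j = 0)"
    if len: "length nbs = n" and nbs: "\<forall>j\<in>set [0..<n]. distinct (nbs ! j) \<and> (\<forall>u\<in>set [0..<n]. u \<in> set (nbs ! j) \<longleftrightarrow> adj t u j) \<and> (\<forall>u\<in>set (nbs ! j). u < n)"
      and z: "first_zero_row nbs m (map (\<lambda>j. if j = 0 then 1 else 0) [0..<n]) (map (\<lambda>j. if adj t 0 j then 1 else 0) [0..<n])" for nbs m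
  proof -
    have dist: "distinct (nbs ! j) \<and> set (nbs ! j) = nb j" if j: "j < n" for j
    proof (intro conjI set_eqI)
      have j': "j \<in> set [0..<n]" using j by simp
      then show "distinct (nbs ! j)" using nbs by blast
      fix u
      have "u < n" if "adj t u j" using adj_rank[OF that] by (simp add: t)
      moreover have "u \<in> set [0..<n] \<Longrightarrow> u \<in> set (nbs ! j) \<longleftrightarrow> adj t u j" "u \<in> set (nbs ! j) \<Longrightarrow> u < n"
        using nbs j' by blast+
      moreover have "u \<in> nb j \<longleftrightarrow> adj t u j" "u \<in> set [0..<n] \<longleftrightarrow> u < n" by (simp_all add: nb_def)
      ultimately show "u \<in> set (nbs ! j) \<longleftrightarrow> u \<in> nb j" by blast
    qed
    have rows: "map (row 0) [0..<n] = map (\<lambda>j. if j = 0 then 1 else 0) [0..<n]"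
      "map (row (Suc 0)) [0..<n] = map (\<lambda>j. if adj t 0 j then 1 else 0) [0..<n]"
      by (simp_all add: row_0 row_1)
    have "rank t = n" by (simp add: t)
    from first_zero_row_sound[OF len dist this z[folded rows]] show ?thesis by simp
  qed
  have n: "n \<in> {6, 7, 8}" using valid t by simp
  then consider "n = 6" | "n = 7" | "n = 8" by auto
  then show ?thesis
  proof cases
    case 1
    \<comment> \<open>The last nonzero row has index h - 2, which is 10, 16 and 28 for h = 12, 18
      and 30.\<close>
    have "(\<forall>k\<le>10. \<exists>j. row k j \<noteq> 0) \<and> (\<forall>j. row (Suc 10) j = 0)"
      by (rule main[of "[[1], [0, 2], [1, 3, 5], [2, 4], [3], [2]]"]; unfold t 1; code_simp)
    then show ?thesis by (simp add: t 1 less_Suc_eq_le[of _ 10, simplified])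
  next
    case 2
    have "(\<forall>k\<le>16. \<exists>j. row k j \<noteq> 0) \<and> (\<forall>j. row (Suc 16) j = 0)"
      by (rule main[of "[[1], [0, 2], [1, 3, 6], [2, 4], [3, 5], [4], [2]]"]; unfold t 2; code_simp)
    then show ?thesis by (simp add: t 2 less_Suc_eq_le[of _ 16, simplified])
  next
    case 3
    have "(\<forall>k\<le>28. \<exists>j. row k j \<noteq> 0) \<and> (\<forall>j. row (Suc 28) j = 0)"
      by (rule main[of "[[1], [0, 2], [1, 3, 7], [2, 4], [3, 5], [4, 6], [5], [2]]"]; unfold t 3; code_simp)
    then show ?thesis by (simp add: t 3 less_Suc_eq_le[of _ 28, simplified])
  qed
qed

lemma first_zero:
  shows "l < coxeter_number t - 1 \<Longrightarrow> \<exists>j. row l j \<noteq> 0"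
    and "row (coxeter_number t - 1) j = 0"
proof -
  have "(\<forall>l<coxeter_number t - 1. \<exists>j. row l j \<noteq> 0) \<and> (\<forall>j. row (coxeter_number t - 1) j = 0)"
  proof (cases t)
    case (TypeA n)
    then show ?thesis using row_A[OF TypeA] by simp
  next
    case t: (TypeD n)
    have n: "n \<ge> 4" using valid t by simp
    have "\<exists>j. row l j \<noteq> 0" if l: "l < 2 * n - 3" for l
    proof -
      consider "l \<le> n - 3" | "l = n - 2" | "n - 1 \<le> l" using n by linarith
      then show ?thesis
      proof cases
        case 1
        then show ?thesis using row_D(1)[OF t 1, of l] by (intro exI[of _ l]) simp
      next
        case 2
        then show ?thesis using row_D(2)[OF t, of l] by (intro exI[of _ l]) simp
      next
        case 3
        then have "row l (n - 3 - (l - (n - 1))) = 1"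
          using row_D(3)[OF t, of "l - (n - 1)" "n - 3 - (l - (n - 1))"] l by simp
        then have "row l (n - 3 - (l - (n - 1))) \<noteq> 0" by simp
        then show ?thesis by blast
      qed
    qed
    then show ?thesis using row_D(4)[OF t] by (simp add: t)
  next
    case (TypeE n)
    then show ?thesis using row_E by blast
  qed
  then show "l < coxeter_number t - 1 \<Longrightarrow> \<exists>j. row l j \<noteq> 0" and "row (coxeter_number t - 1) j = 0" by blast+
qed

subsection \<open>Periodicity\<close>

text \<open>Connectedness of the diagram, in the form that spreads a zero row. The chain from 0
  reaches every vertex except, in types D and E, the last one, which hangs on the branch
  vertex.\<close>

lemma adj_invariant:
  assumes inv: "\<And>u v. adj t u v \<Longrightarrow> P u \<longleftrightarrow> P v" and i: "i < rank t"
  shows "P i \<longleftrightarrow> P 0"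
proof -
  have chain: "P k \<longleftrightarrow> P 0" if "\<And>v. Suc v \<le> k \<Longrightarrow> adj t v (Suc v)" for k
    using that
  proof (induction k)
    case (Suc k)
    then show ?case using inv[of k "Suc k"] by simp
  qed simp
  show ?thesis
  proof (cases t)
    case (TypeA n)
    then show ?thesis using i by (intro chain) (auto simp: adj_def)
  next
    case t: (TypeD n)
    have n: "n \<ge> 4" using valid t by simp
    show ?thesis
    proof (cases "i = n - 1")
      case False
      then show ?thesis using i t by (intro chain) (auto simp: adj_def)
    next
      case True
      have "P (n - 3) \<longleftrightarrow> P 0" using n t by (intro chain) (auto simp: adj_def)
      moreover have "adj t (n - 3) (n - 1)" using n t by (auto simp: adj_def)
      ultimately show ?thesis using inv True by blast
    qed
  next
    case t: (TypeE n)
    have n: "n \<ge> 6" using valid t by auto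
    show ?thesis
    proof (cases "i = n - 1")
      case False
      then show ?thesis using i t by (intro chain) (auto simp: adj_def)
    next
      case True
      have "P 2 \<longleftrightarrow> P 0" using n t by (intro chain) (auto simp: adj_def)
      moreover have "adj t 2 (n - 1)" using n t by (auto simp: adj_def)
      ultimately show ?thesis using inv True by blast
    qed
  qed
qed

text \<open>By \<open>chi_adj_comm\<close> the rows of the neighbours of v add up to the row of v
  times the adjacency matrix. If the row of v is zero, nonnegativity makes each of them
  zero.\<close>

lemma chi_zero_row:
  assumes nn: "\<And>i j. i < rank t \<Longrightarrow> chi i j (int l) \<ge> 0" and i: "i < rank t"
  shows "(\<forall>j. chi i j (int l) = 0) \<longleftrightarrow> (\<forall>j. chi 0 j (int l) = 0)"
proof -
  have spread: "\<forall>j. chi u j (int l) = 0" if "adj t u v" "\<forall>j. chi v j (int l) = 0" for u v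
  proof
    fix j
    have "(\<Sum>w\<in>nb v. chi w j (int l)) = 0" using that(2) by (simp add: chi_adj_comm)
    moreover have "\<forall>w\<in>nb v. chi w j (int l) \<ge> 0" using nn adj_rank by (auto simp: nb_def)
    moreover have "u \<in> nb v" using that(1) by (simp add: nb_def)
    ultimately show "chi u j (int l) = 0" using sum_nonneg_eq_0_iff[of "nb v" "\<lambda>w. chi w j (int l)"] by simp
  qed
  show ?thesis
    by (rule adj_invariant[where P = "\<lambda>i. \<forall>j. chi i j (int l) = 0", OF _ i]) (use spread adj_sym in blast)
qed

text \<open>All vertices reach the first zero row at the same time: if \<open>i\<close> does so first, then the rows of
  its neighbours are nonnegative with sum zero.\<close>
lemma all_good:
  assumes "l < coxeter_number t - 1" and "i < rank t"
  shows "good TYPE('k::field) i (int l)"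
  using assms
proof (induction l arbitrary: i)
  case 0
  then show ?case using good_0 by simp
next
  case (Suc l)
  have IH: "good TYPE('k) i (int l)" if "i < rank t" for i using Suc that by simp
  have nn: "chi i j (int (Suc l)) \<ge> 0" if "i < rank t" for i j
    using good_chi(2)[OF IH[OF that]] by (simp add: add.commute)
  have nz: "\<not> (\<forall>j. chi i j (int (Suc l)) = 0)"
    using chi_zero_row[OF nn Suc.prems(2)] first_zero(1)[OF Suc.prems(1)] by (auto simp: row_def)
  have "theta_inj TYPE('k) i (int l)"
  proof (rule ccontr)
    assume "\<not> ?thesis"
    then obtain v where "simple_end TYPE('k) i (int l) v"
      using brick_dichotomy IH[OF Suc.prems(2)] unfolding good_def by blast
    then show False using nz simple_end_chi(1)[OF IH[OF Suc.prems(2)]] by (simp add: add.commute)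
  qed
  then show ?case using good_step[OF IH[OF Suc.prems(2)]] by (simp add: add.commute)
qed

lemma coxeter_number_ge: "coxeter_number t \<ge> 2"
  using valid by (cases t) auto

text \<open>All rows vanish at length h - 1, so \<open>good\<close> fails there, and by
  \<open>good_step\<close> injectivity of theta must fail at h - 2. The vertex v is the image of i
  under the Nakayama permutation.\<close>

lemma nakayama:
  assumes i: "i < rank t"
  defines "l \<equiv> int (coxeter_number t) - 2"
  shows "\<exists>v. v < rank t \<and> good TYPE('k::field) i l \<and> simple_end TYPE('k) i l v"
proof -
  define m where "m = coxeter_number t - 2"
  have m: "l = int m" "coxeter_number t - 1 = Suc m" using coxeter_number_ge by (auto simp: l_def m_def)
  have g: "good TYPE('k) i (int m)" if "i < rank t" for i
    by (rule all_good) (use that m in simp_all)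
  have nn: "chi i j (int (Suc m)) \<ge> 0" if "i < rank t" for i j
    using good_chi(2)[OF g[OF that]] by (simp add: add.commute)
  have "\<forall>j. chi i j (int (Suc m)) = 0"
    using chi_zero_row[OF nn i] first_zero(2)[unfolded m(2) row_def] by blast
  then have "\<not> good TYPE('k) i (int m + 1)" using good_chi(3) by (metis of_nat_Suc add.commute)
  then have "\<not> theta_inj TYPE('k) i (int m)" using good_step[OF g[OF i]] by auto
  then obtain v where v: "simple_end TYPE('k) i (int m) v"
    using brick_dichotomy g[OF i] unfolding good_def by blast
  moreover have "chi i v (int m) = 1" using simple_end_chi(2)[OF g[OF i] v, of v] by simp
  then have "v < rank t" using chi_rank by (metis zero_neq_one)
  ultimately show ?thesis using g[OF i] m by auto
qed

text \<open>At length l the row of i is the unit vector at v and the row of v is the unit vector at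
  w; the matrix is symmetric.\<close>

lemma nakayama_involutive:
  assumes "good TYPE('k::field) i (int l)" "simple_end TYPE('k) i (int l) v"
    and "good TYPE('k) v (int l)" "simple_end TYPE('k) v (int l) w"
  shows "w = i"
  using simple_end_chi(2)[OF assms(1,2), of v] simple_end_chi(2)[OF assms(3,4), of i] chi_sym[of i v l]
  by (auto split: if_splits)

section \<open>The cocycle that induces the shift\<close>

lemma coef_single_Nil: "coef a (single []) = 0"
  by (auto simp: coef_def single_def fun_eq_iff fun_apply)

lemma rmul_one: "rmul z (single []) = z"
proof (rule word_fun_eqI)
  show "coef a (rmul z (single [])) = coef a z" for a
    unfolding coef_rmul coef_single_Nil by (simp add: single_def)
qed (simp add: single_def)

lemma C_length_0:
  assumes "f \<in> C i j 0 k"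
  shows "f = (if k = 0 \<and> i = j then smul (f []) (single []) else 0)"
proof -
  have "words i j 0 k \<subseteq> (if k = 0 \<and> i = j then {[]} else {})"
    using words_00[of i j] words_empty[of 0 k i j] by (cases "k = 0") (auto simp: neq_iff)
  then have "f w = (if k = 0 \<and> i = j then smul (f []) (single []) else 0) w" for w
    using assms by (auto simp: C_def single_def fun_apply split: if_splits)
  then show ?thesis by blast
qed

text \<open>Here l_{v0} x0 has differential theta_{v0} x0, whose components are exact because
  Pi_{l+1} is zero; subtracting their primitives behind the arrows gives z. In the base case of
  length 0 the source is spanned by the idempotent at v0 and the cohomology of the target by the
  class of z.\<close>

lemma nakayama_cocycle:
  assumes g: "good TYPE('k::field) i l" and s: "simple_end TYPE('k) i l v0" and l: "l \<ge> 0"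
    and v0: "v0 < rank t"
  shows "\<exists>z :: letter list \<Rightarrow> 'k. z \<in> Z i v0 (l + 2) 1 \<and> (\<forall>m. rmul_qis z i v0 (l + 2) 1 (int m))"
proof -
  have ac: "Z i v l k \<subseteq> (B i v l k :: (letter list \<Rightarrow> 'k) set)" if "k \<ge> 1" for k v
    using g that by (auto simp: good_def)
  have ac1: "Z i v (l + 1) k \<subseteq> (B i v (l + 1) k :: (letter list \<Rightarrow> 'k) set)" for k v
  proof -
    consider "k \<ge> 1" | "k = 0" | "k < 0" by linarith
    then show ?thesis
    proof cases
      case 1
      then show ?thesis using g by (auto simp: good_def)
    next
      case 2
      then show ?thesis using s Z_sub_C by (fastforce simp: simple_end_def)
    next
      case 3
      show ?thesis
      proof
        fix x :: "letter list \<Rightarrow> 'k" assume "x \<in> Z i v (l + 1) k"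
        then have "x = 0" using C_trivial[OF _ Z_sub_C, of "l + 1" k x i v] 3 by blast
        then show "x \<in> B i v (l + 1) k" by simp
      qed
    qed
  qed
  \<comment> \<open>The arrow components have length l + 1 and are acyclic, so a class of length l +
    2 is determined by its component behind l_j.\<close>
  have cone: "f \<in> B i j (l + 2) (k + 1)" 
    if f: "f \<in> Z i j (l + 2) (k + 1)" and b: "coef (Lp j) f \<in> B i j l k" for f :: "letter list \<Rightarrow> 'k" and j k
  proof (rule cone_boundary[OF f])
    show "l + 2 \<noteq> 0" using l by simp
    show "coef (Lp j) f \<in> B i j (l + 2 - 2) (k + 1 - 1)" using b by simp
    show "(Z i v (l + 2 - 1) (k + 1) :: (letter list \<Rightarrow> 'k) set) \<subseteq> B i v (l + 2 - 1) (k + 1)" for v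
      using ac1[of v "k + 1"] by (simp add: algebra_simps)
  qed
  obtain x0 :: "letter list \<Rightarrow> 'k" where x0: "x0 \<in> C i v0 l 0" "x0 \<notin> B i v0 l 0"
      "\<And>x. x \<in> C i v0 l 0 \<Longrightarrow> \<exists>c. x - smul c x0 \<in> B i v0 l 0"
    using s unfolding simple_end_def by blast
  have "\<exists>y \<in> C i v (l + 1) 1. twist v0 v x0 = d y" if "adj t v v0" for v
  proof -
    have "twist v0 v x0 \<in> C i v (l + 1) 0"
      using C_twist[of x0 i v0 "l + 2" 0 v] x0(1) that adj_sym by (simp add: algebra_simps)
    then have "twist v0 v x0 \<in> B i v (l + 1) 0" using s by (auto simp: simple_end_def)
    then show ?thesis by (auto simp: B_def)
  qed
  then obtain y where y: "\<And>v. adj t v v0 \<Longrightarrow> y v \<in> C i v (l + 1) 1 \<and> twist v0 v x0 = d (y v)" by metis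
  define z where "z = asm v0 (\<lambda>v. - y v) x0"
  have zC: "z \<in> C i v0 (l + 2) 1"
    unfolding z_def
  proof (rule C_asm)
    show "- y v \<in> C i v (l + 2 - 1) 1" if "adj t v v0" for v
      using y[OF that] C_subspace(3)[of "y v" i v "l + 1" 1] by (simp add: algebra_simps)
  qed (use x0 in simp)
  have "d z = 0"
  proof (rule C_eqI[OF C_d[OF zC] C_zero])
    show "coef (Lp v0) (d z) = coef (Lp v0) 0" using C0_closed[OF x0(1)] by (simp add: z_def coef_d_at)
    show "coef (Arr v v0) (d z) = coef (Arr v v0) 0" if "adj t v v0" for v
      using y[OF that] that by (simp add: z_def coef_d_at)
  qed (use l in simp)
  then have z: "z \<in> Z i v0 (l + 2) 1" using zC by (simp add: Z_def)
  have zL: "coef (Lp v0) z = x0" by (simp add: z_def)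
  \<comment> \<open>The source is zero and the target, of length l + 1, is acyclic.\<close>
  have Q0: "rmul_qis z i v0 (l + 2) 1 (- 1)"
    unfolding rmul_qis_def
  proof (intro allI conjI ballI impI)
    fix j k and f :: "letter list \<Rightarrow> 'k" assume "f \<in> Z i j (- 1 + (l + 2)) (k + 1)"
    then have "f \<in> B i j (- 1 + (l + 2)) (k + 1)" using ac1[of j "k + 1"] by (auto simp: algebra_simps)
    then show "\<exists>x\<in>Z v0 j (- 1) k. f - rmul z x \<in> B i j (- 1 + (l + 2)) (k + 1)"
      by (intro bexI[of _ 0]) (auto simp: Z_def)
  next
    fix j k and x :: "letter list \<Rightarrow> 'k" assume "x \<in> Z v0 j (- 1) k"
    then have "x = 0" using C_trivial[OF _ Z_sub_C, of "- 1" k x v0 j] by simp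
    then show "x \<in> B v0 j (- 1) k" by simp
  qed
  have Q1: "rmul_qis z i v0 (l + 2) 1 0"
    unfolding rmul_qis_def
  proof (intro allI conjI ballI impI)
    fix j k and f :: "letter list \<Rightarrow> 'k" assume "f \<in> Z i j (0 + (l + 2)) (k + 1)"
    then have f: "f \<in> Z i j (l + 2) (k + 1)" by simp
    have fL: "coef (Lp j) f \<in> Z i j l k" using Z_coef(1)[OF f] by simp
    show "\<exists>x\<in>Z v0 j 0 k. f - rmul z x \<in> B i j (0 + (l + 2)) (k + 1)"
    proof (cases "k = 0 \<and> j = v0")
      case True
      obtain c where c: "coef (Lp j) f - smul c x0 \<in> B i v0 l 0"
        using x0(3) Z_sub_C[OF fL] True by blast
      \<comment> \<open>The l-component of z is x0, so c z has the same class as f, and c z is the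
        image of c times the idempotent.\<close>
      have "f - smul c z \<in> B i j (l + 2) (k + 1)"
      proof (rule cone)
        show "f - smul c z \<in> Z i j (l + 2) (k + 1)"
          using f z True by (intro Z_subspace) auto
        show "coef (Lp j) (f - smul c z) \<in> B i j l k" using c zL True by simp
      qed
      moreover have "smul c (single []) \<in> Z v0 j 0 k"
        using True C_single[of "[]" v0 v0 0 0] v0 
        by (auto simp: words_Nil Z_def C0_closed intro: C_subspace)
      ultimately show ?thesis by (intro bexI[of _ "smul c (single [])"]) (auto simp: rmul_one)
    next
      case False
      have "coef (Lp j) f \<in> B i j l k"
      proof -
        consider "k \<ge> 1" | "k = 0" "j \<noteq> v0" | "k < 0" using False by linarith
        then show ?thesis
        proof cases
          case 1 then show ?thesis using ac fL by blast
        next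
          case 2 then show ?thesis using s Z_sub_C[OF fL] by (auto simp: simple_end_def)
        next
          case 3 then show ?thesis using C_trivial[OF _ Z_sub_C[OF fL]] by simp
        qed
      qed
      then show ?thesis using cone[OF f] by (intro bexI[of _ 0]) (auto simp: Z_def)
    qed
  next
    fix j k and x :: "letter list \<Rightarrow> 'k"
    assume x: "x \<in> Z v0 j 0 k" and b: "rmul z x \<in> B i j (0 + (l + 2)) (k + 1)"
    have eq: "x = (if k = 0 \<and> v0 = j then smul (x []) (single []) else 0)"
      by (rule C_length_0[OF Z_sub_C[OF x]])
    have "x = 0"
    proof (cases "k = 0 \<and> v0 = j")
      case True
      then have "rmul z x = smul (x []) z" using eq by (metis rmul_linear(3) rmul_one)
      then obtain g where gC: "g \<in> C i v0 (l + 2) 2" and "smul (x []) z = d g"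
        using b True by (auto simp: B_def)
      \<comment> \<open>Comparing the components behind l_{v0} shows that a multiple of x0 is a
        boundary, and x0 is none.\<close>
      then have "smul (x []) x0 = d (- coef (Lp v0) g)"
        using zL coef_d_at(1)[of v0 g] coef_simps(5)[of "Lp v0" "x []" z] by simp
      moreover have "- coef (Lp v0) g \<in> C i v0 l 1" using C_subspace(3)[OF C_coef(2)[OF gC]] by simp
      ultimately have "smul (x []) x0 \<in> B i v0 l 0" by (metis B_def add_0 image_eqI)
      then have xx: "smul (inverse (x [])) (smul (x []) x0) \<in> B i v0 l 0" by (rule B_subspace(4))
      have "x [] = 0"
      proof (rule ccontr)
        assume "x [] \<noteq> 0"
        then have "smul (inverse (x [])) (smul (x []) x0) = x0" by simp
        then show False using xx x0(2) by metis
      qed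
      then show ?thesis using eq True by simp
    next
      case False
      then show ?thesis using eq unfolding if_not_P[OF False] by blast
    qed
    then show "x \<in> B v0 j 0 k" by simp
  qed
  have "rmul_qis z i v0 (l + 2) 1 (int m)" for m
    using l by (intro rmul_qis_all[OF z _ Q0 Q1]) simp
  then show ?thesis using z by blast
qed

section \<open>Agreement with the complexes of the statement\<close>

lemma C_cochains: "cochains t i j l m = (C i j (int l) (- m) :: (letter list \<Rightarrow> 'k::field) set)"
  by (auto simp: cochains_def C_def basis_def words_def)

lemma basis_words: "basis t i j l m = words i j (int l) (- m)"
  by (auto simp: basis_def words_def)

lemma dbasis_Nil: "dbasis t eps [] w' = 0"
  by (simp add: dbasis_def)

definition dbasis_term :: "letter list \<Rightarrow> letter list \<Rightarrow> nat \<Rightarrow> 'k::field" where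
  "dbasis_term w w' p = (case w ! p of Arr _ _ \<Rightarrow> 0 | Lp u \<Rightarrow> (- 1) ^ nL (take p w) *
     (\<Sum>v\<in>{v. v < rank t \<and> adj t u v}. e u v *
       (if w' = take p w @ [Arr v u, Arr u v] @ drop (Suc p) w then 1 else 0)))"

lemma dbasis_eq: "dbasis t eps w w' = (\<Sum>p<length w. dbasis_term w w' p)"
  by (simp add: dbasis_def dbasis_term_def)

text \<open>A replacement behind the first letter keeps that letter and sees one more l to its left
  exactly if the letter is an l.\<close>

lemma dbasis_term_Suc:
  "dbasis_term (a # w) w' (Suc p) = (if is_L a then - 1 else 1) *
     (case w' of [] \<Rightarrow> 0 | b # w'' \<Rightarrow> if b = a then dbasis_term w w'' p else 0)"
proof (cases "w ! p")
  case (Lp u)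
  show ?thesis
    by (cases w') (auto simp: dbasis_term_def Lp nL_def)
qed (auto simp: dbasis_term_def split: list.splits)

lemma dbasis_Cons_eq:
  "dbasis t eps (a # w) w' = dbasis_term (a # w) w' 0 + (if is_L a then - 1 else 1) * lmul a (dbasis t eps w) w'"
proof -
  have "dbasis t eps (a # w) w' = dbasis_term (a # w) w' 0 + (\<Sum>p<length w. dbasis_term (a # w) w' (Suc p))"
    by (simp add: dbasis_eq sum.lessThan_Suc_shift del: sum.lessThan_Suc)
  also have "(\<Sum>p<length w. dbasis_term (a # w) w' (Suc p)) = (if is_L a then - 1 else 1) * lmul a (dbasis t eps w) w'"
    unfolding dbasis_term_Suc lmul_def sum_distrib_left[symmetric]
    by (cases w') (simp_all add: dbasis_eq)
  finally show ?thesis .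
qed

lemma dbasis_Cons:
  "dbasis t eps (Arr v u # w) w' = lmul (Arr v u) (dbasis t eps w) w'"
  "dbasis t eps (Lp u # w) w' = - lmul (Lp u) (dbasis t eps w) w' +
    (\<Sum>v\<in>{v. v < rank t \<and> adj t u v}. e u v * (if w' = Arr v u # Arr u v # w then 1 else 0))"
  unfolding dbasis_Cons_eq by (simp_all add: dbasis_term_def nL_def)

lemma d_lmul_Lp:
  "d (lmul (Lp u) f) = - lmul (Lp u) (d f) + (\<Sum>v\<in>nb u. smul (e u v) (lmul (Arr v u) (lmul (Arr u v) f)))"
proof (rule word_fun_eqI)
  show "d (lmul (Lp u) f) [] = (- lmul (Lp u) (d f) + (\<Sum>v\<in>nb u. smul (e u v) (lmul (Arr v u) (lmul (Arr u v) f)))) []"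
    by (simp add: fun_apply fun_sum_apply)
  fix a
  show "coef a (d (lmul (Lp u) f)) = coef a (- lmul (Lp u) (d f) + (\<Sum>v\<in>nb u. smul (e u v) (lmul (Arr v u) (lmul (Arr u v) f))))"
  proof (cases a)
    case (Lp u')
    then show ?thesis by (simp add: coef_d coef_sum)
  next
    case (Arr v' u')
    have "coef a (\<Sum>v\<in>nb u. smul (e u v) (lmul (Arr v u) (lmul (Arr u v) f))) =
      (\<Sum>v\<in>nb u. if v = v' then if u' = u then smul (e u v) (lmul (Arr u v) f) else 0 else 0)"
      unfolding coef_sum by (rule sum.cong) (auto simp: Arr)
    also have "\<dots> = (if v' \<in> nb u \<and> u' = u then smul (e u v') (lmul (Arr u v') f) else 0)"
      by simp
    finally show ?thesis using adj_sym[of u v'] by (auto simp: coef_d Arr nb_def)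
  qed
qed

lemma single_Cons: "single (a # w) = lmul a (single w)"
  by (rule word_fun_eqI) (auto simp: single_def coef_def lmul_def fun_eq_iff)

text \<open>Both sides obey the same recursion in the first letter, by \<open>d_lmul_Arr\<close>,
  \<open>d_lmul_Lp\<close> and \<open>dbasis_Cons\<close>.\<close>

lemma d_single: "d (single w) = (dbasis t eps w :: letter list \<Rightarrow> 'k::field)"
proof (induction w)
  case Nil
  have "coef a (d (single [])) = coef a (0 :: letter list \<Rightarrow> 'k)" for a
    by (cases a) (simp_all add: coef_d coef_single_Nil)
  then have "d (single []) = (0 :: letter list \<Rightarrow> 'k)"
    by (intro word_fun_eqI[of "d (single [])" 0]) (simp_all add: fun_apply)
  then show "d (single []) = (dbasis t eps [] :: letter list \<Rightarrow> 'k)" by (auto simp: fun_eq_iff dbasis_Nil fun_apply)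
next
  case (Cons a w)
  have IH: "d (single w) = (dbasis t eps w :: letter list \<Rightarrow> 'k)" by (rule Cons.IH)
  show "d (single (a # w)) = (dbasis t eps (a # w) :: letter list \<Rightarrow> 'k)"
  proof (cases a)
    case (Arr v u)
    then show ?thesis by (simp add: single_Cons IH fun_eq_iff dbasis_Cons)
  next
    case (Lp u)
    have nb: "nb u = {v. v < rank t \<and> adj t u v}" using adj_sym adj_rank by (auto simp: nb_def)
    have s: "lmul (Arr v u) (lmul (Arr u v) (single w)) w' = (if w' = Arr v u # Arr u v # w then 1 else 0 :: 'k)" for v w'
      unfolding single_Cons[symmetric] by (simp add: single_def)
    have "d (single (a # w)) w' = (dbasis t eps (a # w) w' :: 'k)" for w'
      unfolding Lp single_Cons d_lmul_Lp IH dbasis_Cons plus_fun_apply uminus_apply fun_sum_apply smul_simps nb s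
      by (rule refl)
    then show ?thesis by blast
  qed
qed

lemma diff_eq_d:
  assumes "f \<in> C i j (int l) (- m)"
  shows "diff t eps i j l m f = d f"
proof
  fix w'
  have "d f w' = (\<Sum>w\<in>words i j (int l) (- m). f w * d (single w) w')"
    by (subst C_expand[OF assms]) (simp add: d_sum fun_sum_apply fun_apply)
  then show "diff t eps i j l m f w' = d f w'"
    by (simp add: diff_def basis_words d_single)
qed

end

theorem mainTheorem12:
  fixes t :: dynkin and eps :: "nat \<Rightarrow> nat \<Rightarrow> int" and i j l :: nat
  assumes "dynkin_valid t" and "i < rank t" and "j < rank t"
    and "\<forall>u v. adj t u v \<longrightarrow> eps u v \<in> {1, -1} \<and> eps v u = - eps u v"
  shows "\<exists>phi :: int \<Rightarrow> (letter list \<Rightarrow> 'k::field) \<Rightarrow> (letter list \<Rightarrow> 'k).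
           quasi_iso (\<lambda>n. cochains t i j l (n + 2)) (\<lambda>n. diff t eps i j l (n + 2))
                     (\<lambda>n. cochains t i j (l + 2 * coxeter_number t) n)
                     (\<lambda>n. diff t eps i j (l + 2 * coxeter_number t) n) phi"
proof -
  interpret dynkin_quiver t eps using assms by unfold_locales
  define h where "h = int (coxeter_number t)"
  have h: "h - 2 = int (coxeter_number t - 2)" using coxeter_number_ge by (simp add: h_def)
  then have h0: "0 \<le> h - 2" by simp
  obtain v where v: "v < rank t" "good TYPE('k) i (h - 2)" "simple_end TYPE('k) i (h - 2) v"
    using nakayama[OF assms(2)] unfolding h_def by blast
  obtain v' where v': "good TYPE('k) v (h - 2)" "simple_end TYPE('k) v (h - 2) v'"
    using nakayama[OF v(1)] unfolding h_def by blast
  \<comment> \<open>Thus the second cocycle leads from v back to i.\<close>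
  have vi: "v' = i" using nakayama_involutive v v' unfolding h by blast
  obtain z :: "letter list \<Rightarrow> 'k" where z: "z \<in> Z i v h 1" "\<And>m. rmul_qis z i v h 1 (int m)"
    using nakayama_cocycle[OF v(2,3) h0 v(1)] by auto
  obtain z' :: "letter list \<Rightarrow> 'k" where z': "z' \<in> Z v i h 1" "\<And>m. rmul_qis z' v i h 1 (int m)"
    using nakayama_cocycle[OF v'(1) v'(2)[unfolded vi] h0 assms(2)] by auto
  have dz: "d z = 0" "d z' = 0" using z z' by (auto simp: Z_def)
  \<comment> \<open>This is x z' z. Read from the right, z leads from i to v and z' from v to i, so
    the end points of x are kept. The same formula serves in all degrees.\<close>
  define p where "p x = rmul z (rmul z' x)" for x
  have p_lin: "p (x + y) = p x + p y" "p (smul c x) = smul c (p x)" for x y c by (simp_all add: p_def)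
  have dp: "d (p x) = p (d x)" for x by (simp add: p_def d_rmul dz)
  define L where "L = int (l + 2 * coxeter_number t)"
  have L: "L = int l + h + h" by (simp add: L_def h_def)
  have pC': "rmul z' x \<in> C v j (int l + h) (k + 1)" if "x \<in> C i j (int l) k" for x k
    using C_rmul[OF Z_sub_C[OF z'(1)] that] .
  have pC: "p x \<in> C i j L (k + 2)" if "x \<in> C i j (int l) k" for x k
    using C_rmul[OF Z_sub_C[OF z(1)] pC'[OF that]] by (simp add: p_def L algebra_simps)
  have lh: "int l + h = int (l + coxeter_number t)" by (simp add: h_def)
  have surj: "\<exists>x\<in>Z i j (int l) k. p x - f \<in> B i j L (k + 2)" if f: "f \<in> Z i j L (k + 2)" for f k
  proof -
    have "f \<in> Z i j (int l + h + h) (k + 1 + 1)" using f by (simp add: L algebra_simps)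
    then obtain y g where y: "y \<in> Z v j (int l + h) (k + 1)" and g: "g \<in> C i j (int l + h + h) (k + 1 + 1 + 1)"
      and fy: "f = rmul z y + d g"
      using rmul_qis_surj[OF z(2)] unfolding lh by blast
    obtain x g' where x: "x \<in> Z i j (int l) k" and g': "g' \<in> C v j (int l + h) (k + 1 + 1)"
      and yx: "y = rmul z' x + d g'"
      using rmul_qis_surj[OF z'(2) y] by blast
    \<comment> \<open>Substituting y = x z' + d g' into f = y z + d g gives f = x z' z + d(g' z +
      g), because z is closed.\<close>
    have "rmul z g' \<in> C i j (int l + h + h) (k + 1 + 1 + 1)"
      by (rule C_rmul[OF Z_sub_C[OF z(1)] g'])
    from C_subspace(3)[OF C_subspace(1)[OF this g]] have "- (rmul z g' + g) \<in> C i j L (k + 2 + 1)"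
      by (simp only: L add.assoc) simp
    moreover have "p x - f = d (- (rmul z g' + g))"
      using fy yx by (simp add: p_def d_rmul dz)
    ultimately show ?thesis using x unfolding B_def by blast
  qed
  have inj: "x \<in> B i j (int l) k" if x: "x \<in> Z i j (int l) k" and b: "p x \<in> B i j L (k + 2)" for x k
  proof -
    have y: "rmul z' x \<in> Z v j (int l + h) (k + 1)"
      using pC'[OF Z_sub_C[OF x]] x by (auto simp: Z_def d_rmul dz)
    have "rmul z (rmul z' x) \<in> B i j (int l + h + h) (k + 1 + 1)"
      using b by (simp add: L p_def algebra_simps)
    then have "rmul z' x \<in> B v j (int l + h) (k + 1)"
      using z(2)[of "l + coxeter_number t"] y unfolding rmul_qis_def lh by blast
    then show ?thesis using z'(2)[of l] x unfolding rmul_qis_def by blast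
  qed
  \<comment> \<open>Turns the pointwise expressions of \<open>quasi_iso\<close> and
    \<open>lin_on\<close> into vector space operations.\<close>
  have fold: "(\<lambda>w. x w + y w) = x + y" "(\<lambda>w. x w - y w) = x - y" "(\<lambda>w. c * x w) = smul c x"
    "(\<lambda>_. 0) = (0 :: letter list \<Rightarrow> 'k)" for x y :: "letter list \<Rightarrow> 'k" and c
    by (auto simp: fun_eq_iff fun_apply)
  have "quasi_iso (\<lambda>n. cochains t i j l (n + 2)) (\<lambda>n. diff t eps i j l (n + 2))
      (\<lambda>n. cochains t i j (l + 2 * coxeter_number t) n)
      (\<lambda>n. diff t eps i j (l + 2 * coxeter_number t) n) (\<lambda>n. p)"
    unfolding quasi_iso_def lin_on_def fold
  proof (intro conjI allI ballI impI)
    fix n :: int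
    \<comment> \<open>The number of letters l in degree n + 2 of the source; the two cocycles add
      two letters, which is degree n of the target.\<close>
    let ?k = "- (n + 2)"
    have k: "?k + 2 = - n" "?k + 2 + 1 = - (n - 1)" "- (n - 1 + 2) = ?k + 1" by simp_all
    have dC: "diff t eps i j l (n + 2) x = d x" if "x \<in> cochains t i j l (n + 2)" for x :: "letter list \<Rightarrow> 'k"
      using that by (intro diff_eq_d) (simp add: C_cochains)
    have dD: "diff t eps i j (l + 2 * coxeter_number t) m x = d x"
      if "x \<in> cochains t i j (l + 2 * coxeter_number t) m" for x :: "letter list \<Rightarrow> 'k" and m
      using that by (intro diff_eq_d) (simp add: C_cochains)
    have pD: "p x \<in> cochains t i j (l + 2 * coxeter_number t) n" if "x \<in> cochains t i j l (n + 2)" for x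
      using pC[of x ?k] that unfolding C_cochains k L_def .
    then show "p ` cochains t i j l (n + 2) \<subseteq> cochains t i j (l + 2 * coxeter_number t) n" by blast
    show "p (x + y) = p x + p y" for x y by (rule p_lin)
    show "p (smul c x) = smul c (p x)" for c x by (rule p_lin)
    show "p (diff t eps i j l (n + 2) x) = diff t eps i j (l + 2 * coxeter_number t) n (p x)"
      if "x \<in> cochains t i j l (n + 2)" for x
      using dC[OF that] dD[OF pD[OF that]] dp by simp
    show "\<exists>x\<in>cochains t i j l (n + 2). diff t eps i j l (n + 2) x = 0 \<and>
        (\<exists>y\<in>cochains t i j (l + 2 * coxeter_number t) (n - 1). p x - f = diff t eps i j (l + 2 * coxeter_number t) (n - 1) y)"
      if f: "f \<in> cochains t i j (l + 2 * coxeter_number t) n" and df: "diff t eps i j (l + 2 * coxeter_number t) n f = 0" for f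
    proof -
      have "f \<in> Z i j L (?k + 2)" using f df dD[OF f] unfolding C_cochains k L_def by (simp add: Z_def)
      then obtain x where x: "x \<in> Z i j (int l) ?k" "p x - f \<in> B i j L (?k + 2)" using surj by blast
      then obtain y where y: "y \<in> C i j L (?k + 2 + 1)" "p x - f = d y" by (auto simp: B_def)
      have xC: "x \<in> cochains t i j l (n + 2)" using x(1) by (simp add: C_cochains Z_def)
      have yC: "y \<in> cochains t i j (l + 2 * coxeter_number t) (n - 1)"
        using y(1) unfolding C_cochains k(2) L_def .
      show ?thesis
      proof (intro bexI[OF _ xC] conjI bexI[OF _ yC])
        show "diff t eps i j l (n + 2) x = 0" using x(1) dC[OF xC] by (simp add: Z_def)
        show "p x - f = diff t eps i j (l + 2 * coxeter_number t) (n - 1) y" using y(2) dD[OF yC] by simp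
      qed
    qed
    show "\<exists>x'\<in>cochains t i j l (n - 1 + 2). x = diff t eps i j l (n - 1 + 2) x'"
      if x: "x \<in> cochains t i j l (n + 2)" and dx: "diff t eps i j l (n + 2) x = 0"
        and ex: "\<exists>y\<in>cochains t i j (l + 2 * coxeter_number t) (n - 1). p x = diff t eps i j (l + 2 * coxeter_number t) (n - 1) y" for x
    proof -
      have "x \<in> Z i j (int l) ?k" using x dx dC[OF x] by (simp add: C_cochains Z_def)
      moreover obtain y where y: "y \<in> cochains t i j (l + 2 * coxeter_number t) (n - 1)"
        "p x = diff t eps i j (l + 2 * coxeter_number t) (n - 1) y" using ex by blast
      have "y \<in> C i j L (?k + 2 + 1)" using y(1) unfolding C_cochains k(2) L_def .
      then have "p x \<in> B i j L (?k + 2)" using y(2) dD[OF y(1)] by (simp add: B_def)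
      ultimately have "x \<in> B i j (int l) ?k" using inj by blast
      then obtain x' where x': "x' \<in> C i j (int l) (?k + 1)" "x = d x'" by (auto simp: B_def)
      have x'C: "x' \<in> cochains t i j l (n - 1 + 2)" using x'(1) unfolding C_cochains k .
      have "diff t eps i j l (n - 1 + 2) x' = d x'"
        using x'C by (intro diff_eq_d) (simp add: C_cochains)
      then have "x = diff t eps i j l (n - 1 + 2) x'" using x'(2) by metis
      then show ?thesis using x'C by blast
    qed
  qed
  then show ?thesis by blast
qed

end
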